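(* Let $p\ge4$, $k\ge p$, $b=2\lceil\frac{k-2}{p-2}\rceil$, $D=p(b-1)$, and let $\bar c=(c_1,\dots,c_b)$ be a 2-flat sequence of integers from $[0,2^{k-1}-1]$. Let $f=f_D\circ f_{D-1}\circ\dots\circ f_1$ where $f_i=Q_{((i-1)\bmod p)+1}$ for $i=1,\dots,D$. Then $f(\bar c)$ is flat.
   Context: Flat: $c_1\le\dots\le c_{2m}\le c_1+1$. 2-flat: $(c_1,c_3,\dots,c_{2m-1})$ and $(c_2,c_4,\dots,c_{2m})$ both flat. Let $h_s=2^{k-s-1}-1$ for $1\le s\le k-1$. Maps $\mathbb R^b\to\mathbb R^b$ (unmentioned coordinates unchanged): $cyc$: coordinate 1 becomes $\max(c_1,c_b-1)$, coordinate $b$ becomes $\min(c_1+1,c_b)$; $dec_{j,s}$ ($1\le j\le b/2$, $1\le s\le k-1$): coordinate $j$ becomes $\min(c_j,c_{b-j+1}+h_s)$, coordinate $b-j+1$ becomes $\max(c_j-h_s,c_{b-j+1})$; $mov_j$ ($1\le j\le b/2$): for $t\in\{j,b-j\}$ coordinate $t$ becomes $\min(c_t,c_{t+1})$, for $t\in\{j+1,b-j+1\}$ coordinate $t$ becomes $\max(c_{t-1},c_t)$. For $x=1,\dots,p$: $MV_x=\{mov_j:1\le j\le\frac{k-2}{p-2},\ x+j\equiv1\pmod p\}$, $DC_x=\{dec_{j,s}:1\le j\le b/2,\ (x+j)\bmod p\notin\{1,2\},\ s=(p-2)(j-1)-1+((x+j-1)\bmod p)\le k-1\}$; $Q_1=\{cyc\}\cup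 MV_1\cup DC_1$, $Q_x=MV_x\cup DC_x$ ($2\le x\le p$). The functions in one $Q_x$ modify pairwise disjoint coordinates, and $Q_x$ denotes the map obtained by composing all of them (in any order). *)

theory Defs
  imports Complex_Main "HOL-Number_Theory.Cong"
begin

text \<open>
  A sequence \<open>(c\<^sub>1, \<dots>, c\<^sub>n)\<close> is a function \<open>c :: nat \<Rightarrow> real\<close> of which only the values at
  \<open>1, \<dots>, n\<close> matter; accordingly a self-map of \<open>\<real>\<^sup>b\<close> is a function on such sequences that
  leaves all positions outside \<open>{1..b}\<close> alone.
\<close>

definition flat :: "nat \<Rightarrow> (nat \<Rightarrow> real) \<Rightarrow> bool" where
  "flat n c \<longleftrightarrow> (\<forall>i. 1 \<le> i \<and> i < n \<longrightarrow> c i \<le> c (i + 1)) \<and> c n \<le> c 1 + 1"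

definition two_flat :: "nat \<Rightarrow> (nat \<Rightarrow> real) \<Rightarrow> bool" where
  "two_flat n c \<longleftrightarrow>
     flat (n div 2) (\<lambda>i. c (2 * i - 1)) \<and> flat (n div 2) (\<lambda>i. c (2 * i))"

definition blk :: "nat \<Rightarrow> nat \<Rightarrow> nat" where
  "blk p k = 2 * nat \<lceil>(real k - 2) / (real p - 2)\<rceil>"

definition hgt :: "nat \<Rightarrow> nat \<Rightarrow> real" where
  "hgt k s = 2 ^ (k - s - 1) - 1"

definition cyc :: "nat \<Rightarrow> (nat \<Rightarrow> real) \<Rightarrow> nat \<Rightarrow> real" where
  "cyc b c = (\<lambda>t. if t = 1 then max (c 1) (c b - 1)
                  else if t = b then min (c 1 + 1) (c b)
                  else c t)"

definition dec :: "nat \<Rightarrow> nat \<Rightarrow> nat \<Rightarrow> nat \<Rightarrow> (nat \<Rightarrow> real) \<Rightarrow> nat \<Rightarrow> real" where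
  "dec b k j s c = (\<lambda>t. if t = j then min (c j) (c (b - j + 1) + hgt k s)
                        else if t = b - j + 1 then max (c j - hgt k s) (c (b - j + 1))
                        else c t)"

definition mov :: "nat \<Rightarrow> nat \<Rightarrow> (nat \<Rightarrow> real) \<Rightarrow> nat \<Rightarrow> real" where
  "mov b j c = (\<lambda>t. if t \<in> {j, b - j} then min (c t) (c (t + 1))
                    else if t \<in> {j + 1, b - j + 1} then max (c (t - 1)) (c t)
                    else c t)"

definition MV :: "nat \<Rightarrow> nat \<Rightarrow> nat \<Rightarrow> ((nat \<Rightarrow> real) \<Rightarrow> nat \<Rightarrow> real) set" where
  "MV p k x = {mov (blk p k) j | j.
     1 \<le> j \<and> real j \<le> (real k - 2) / (real p - 2) \<and> [x + j = 1] (mod p)}"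

text \<open>The index \<open>s\<close> is computed over the integers, since \<open>(p - 2) (j - 1) - 1\<close> is
  negative for \<open>j = 1\<close>.\<close>

definition DC :: "nat \<Rightarrow> nat \<Rightarrow> nat \<Rightarrow> ((nat \<Rightarrow> real) \<Rightarrow> nat \<Rightarrow> real) set" where
  "DC p k x = {dec (blk p k) k j s | j s.
     1 \<le> j \<and> j \<le> blk p k div 2 \<and> (x + j) mod p \<notin> {1, 2} \<and>
     int s = (int p - 2) * (int j - 1) - 1 + int ((x + j - 1) mod p) \<and> s \<le> k - 1}"

definition Q :: "nat \<Rightarrow> nat \<Rightarrow> nat \<Rightarrow> ((nat \<Rightarrow> real) \<Rightarrow> nat \<Rightarrow> real) set" where
  "Q p k x = (if x = 1 then {cyc (blk p k)} else {}) \<union> MV p k x \<union> DC p k x"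

definition compose_all :: "('a \<Rightarrow> 'a) set \<Rightarrow> 'a \<Rightarrow> 'a" where
  "compose_all F = Finite_Set.fold (\<circ>) id F"

definition Qmap :: "nat \<Rightarrow> nat \<Rightarrow> nat \<Rightarrow> (nat \<Rightarrow> real) \<Rightarrow> nat \<Rightarrow> real" where
  "Qmap p k x = compose_all (Q p k x)"


subsection \<open>The composition does not depend on the order\<close>

definition acts_on :: "((nat \<Rightarrow> real) \<Rightarrow> nat \<Rightarrow> real) \<Rightarrow> nat set \<Rightarrow> bool" where
  "acts_on g A \<longleftrightarrow> (\<forall>c i. i \<notin> A \<longrightarrow> g c i = c i) \<and>
     (\<forall>c d. (\<forall>a\<in>A. c a = d a) \<longrightarrow> (\<forall>i\<in>A. g c i = g d i))"

lemma acts_on_commute: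
  assumes "acts_on g A" "acts_on h B" "A \<inter> B = {}"
  shows "g \<circ> h = h \<circ> g"
proof (intro ext)
  fix c i
  have g: "\<And>c i. i \<notin> A \<Longrightarrow> g c i = c i"
    and g': "\<And>c d i. (\<forall>a\<in>A. c a = d a) \<Longrightarrow> i \<in> A \<Longrightarrow> g c i = g d i"
    using assms(1) unfolding acts_on_def by blast+
  have h: "\<And>c i. i \<notin> B \<Longrightarrow> h c i = c i"
    and h': "\<And>c d i. (\<forall>a\<in>B. c a = d a) \<Longrightarrow> i \<in> B \<Longrightarrow> h c i = h d i"
    using assms(2) unfolding acts_on_def by blast+
  have a: "\<forall>a\<in>A. h c a = c a" and b: "\<forall>a\<in>B. g c a = c a"
    using g h assms(3) by blast+
  consider "i \<in> A" "i \<notin> B" | "i \<in> B" "i \<notin> A" | "i \<notin> A" "i \<notin> B" using assms(3) by blast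
  then show "(g \<circ> h) c i = (h \<circ> g) c i"
    by cases (use g' [OF a] h' [OF b] g h in auto)
qed

lemma acts_on_cyc: "acts_on (cyc b) {1, b}"
  by (auto simp: acts_on_def cyc_def)

lemma acts_on_dec: "acts_on (dec b k j s) {j, b - j + 1}"
  by (auto simp: acts_on_def dec_def)

lemma acts_on_mov: "acts_on (mov b j) {j, j + 1, b - j, b - j + 1}"
  by (auto simp: acts_on_def mov_def)

lemma blk_half:
  fixes j :: nat
  assumes "4 \<le> p" "p \<le> k" "real j \<le> (real k - 2) / (real p - 2)"
  shows "2 * j \<le> blk p k"
proof -
  have "int j \<le> \<lceil>(real k - 2) / (real p - 2)\<rceil>"
    using assms(3) by (metis ceiling_mono ceiling_of_nat)
  then show ?thesis unfolding blk_def by linarith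
qed

lemma blk_ge_2: "4 \<le> p \<Longrightarrow> p \<le> k \<Longrightarrow> 2 \<le> blk p k"
  using blk_half[of p k 1] by simp

lemma cong_gap:
  fixes p x i j :: nat
  assumes "[x + i = 1] (mod p)" "[x + j = 1] (mod p)" "i < j"
  shows "i + p \<le> j"
proof -
  have "[x + i = x + j] (mod p)" using assms cong_trans cong_sym by blast
  then have "[i = j] (mod p)" by (simp add: cong_add_lcancel_nat)
  then have "p dvd j - i" using assms(3) by (metis cong_def mod_eq_dvd_iff_nat less_imp_le)
  then have "p \<le> j - i" using assms(3) by (intro dvd_imp_le) auto
  then show ?thesis using assms(3) by linarith
qed

lemma Q_disjoint:
  assumes p: "4 \<le> p" "p \<le> k" and "g \<in> Q p k x" "h \<in> Q p k x" "g \<noteq> h"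
  shows "\<exists>A B. acts_on g A \<and> acts_on h B \<and> A \<inter> B = {} \<and> A \<union> B \<subseteq> {1..blk p k}"
proof -
  define b where "b = blk p k"
  obtain m where m: "b = 2 * m" unfolding b_def blk_def by blast
  have b2: "2 \<le> b" using blk_ge_2[OF p] b_def by simp
  define P where "P = (\<lambda>g h. \<exists>A B. acts_on g A \<and> acts_on h B \<and> A \<inter> B = {} \<and> A \<union> B \<subseteq> {1..b})"
  have PI: "P g h" if "acts_on g A" "acts_on h B" "A \<inter> B = {}" "A \<union> B \<subseteq> {1..b}" for g h A B
    unfolding P_def using that by blast
  have sym: "P g h \<Longrightarrow> P h g" for g h unfolding P_def by (metis Int_commute Un_commute)
  have mvE: "\<exists>j. g = mov b j \<and> 1 \<le> j \<and> 2 * j \<le> b \<and> [x + j = 1] (mod p)"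
    if "g \<in> MV p k x" for g
    using that blk_half[OF p] unfolding MV_def b_def by blast
  have dcE: "\<exists>j s. g = dec b k j s \<and> 1 \<le> j \<and> 2 * j \<le> b \<and> (x + j) mod p \<noteq> 1 \<and>
      (x + j) mod p \<noteq> 2 \<and> int s = (int p - 2) * (int j - 1) - 1 + int ((x + j - 1) mod p)"
    if "g \<in> DC p k x" for g
    using that unfolding DC_def b_def[symmetric] m by force
  have mod1: "(x + j) mod p = 1" "(x + (j + 1)) mod p = 2" if "[x + j = 1] (mod p)" for j
  proof -
    show 1: "(x + j) mod p = 1" using that p unfolding cong_def by simp
    have "(x + (j + 1)) mod p = ((x + j) mod p + 1) mod p" by (metis add.assoc mod_add_left_eq)
    then show "(x + (j + 1)) mod p = 2" using 1 p by simp
  qed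
  have mm: "P (mov b i) (mov b j)"
    if "1 \<le> i" "2 * j \<le> b" "[x + i = 1] (mod p)" "[x + j = 1] (mod p)" "i < j" for i j
  proof -
    have "i + 4 \<le> j" using cong_gap[OF that(3,4,5)] p by linarith
    then have "{i, i + 1, b - i, b - i + 1} \<inter> {j, j + 1, b - j, b - j + 1} = {}"
      "{i, i + 1, b - i, b - i + 1} \<union> {j, j + 1, b - j, b - j + 1} \<subseteq> {1..b}"
      using that(1,2) unfolding m by auto
    then show ?thesis by (rule PI[OF acts_on_mov acts_on_mov])
  qed
  have md: "P (mov b i) (dec b k j s)"
    if "1 \<le> i" "2 * i \<le> b" "1 \<le> j" "2 * j \<le> b" "[x + i = 1] (mod p)"
       "(x + j) mod p \<noteq> 1" "(x + j) mod p \<noteq> 2" for i j s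
  proof -
    have "j \<noteq> i" "j \<noteq> i + 1" using mod1[OF that(5)] that(6,7) by auto
    then have "{i, i + 1, b - i, b - i + 1} \<inter> {j, b - j + 1} = {}"
      "{i, i + 1, b - i, b - i + 1} \<union> {j, b - j + 1} \<subseteq> {1..b}"
      using that(1-4) unfolding m by auto
    then show ?thesis by (rule PI[OF acts_on_mov acts_on_dec])
  qed
  have dd: "P (dec b k i s) (dec b k j t)"
    if "1 \<le> i" "2 * i \<le> b" "1 \<le> j" "2 * j \<le> b" "i \<noteq> j" for i j s t
  proof -
    have "{i, b - i + 1} \<inter> {j, b - j + 1} = {}" "{i, b - i + 1} \<union> {j, b - j + 1} \<subseteq> {1..b}"
      using that unfolding m by auto
    then show ?thesis by (rule PI[OF acts_on_dec acts_on_dec])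
  qed
  have cm: "P (cyc b) (mov b j)" if "1 \<le> j" "2 * j \<le> b" "[1 + j = 1] (mod p)" for j
  proof -
    have "p dvd j" using that(3) by (metis add_0_right cong_0_iff cong_add_lcancel_nat)
    then have "4 \<le> j" using that(1) p dvd_imp_le[of p j] by linarith
    then have "{1, b} \<inter> {j, j + 1, b - j, b - j + 1} = {}"
      "{1, b} \<union> {j, j + 1, b - j, b - j + 1} \<subseteq> {1..b}"
      using that(2) b2 unfolding m by auto
    then show ?thesis by (rule PI[OF acts_on_cyc acts_on_mov])
  qed
  have cd: "P (cyc b) (dec b k j s)" if "1 \<le> j" "2 * j \<le> b" "(1 + j) mod p \<noteq> 2" for j s
  proof -
    have "j \<noteq> 1" using that(3) p by auto
    then have "{1, b} \<inter> {j, b - j + 1} = {}" "{1, b} \<union> {j, b - j + 1} \<subseteq> {1..b}"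
      using that(1,2) b2 unfolding m by auto
    then show ?thesis by (rule PI[OF acts_on_cyc acts_on_dec])
  qed
  have MM: "P g h" if gh: "g \<in> MV p k x" "h \<in> MV p k x" "g \<noteq> h" for g h
  proof -
    obtain i j where *: "g = mov b i" "1 \<le> i" "2 * i \<le> b" "[x + i = 1] (mod p)"
      "h = mov b j" "1 \<le> j" "2 * j \<le> b" "[x + j = 1] (mod p)"
      using mvE[OF gh(1)] mvE[OF gh(2)] by blast
    have "i < j \<or> j < i" using *(1,5) gh(3) by (metis nat_neq_iff)
    then show ?thesis using mm[of i j] mm[of j i] sym * by blast
  qed
  have MD: "P g h" if gh: "g \<in> MV p k x" "h \<in> DC p k x" for g h
    using mvE[OF gh(1)] dcE[OF gh(2)] md by blast
  have DD: "P g h" if gh: "g \<in> DC p k x" "h \<in> DC p k x" "g \<noteq> h" for g h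
  proof -
    obtain i s j t where *: "g = dec b k i s" "1 \<le> i" "2 * i \<le> b"
      "int s = (int p - 2) * (int i - 1) - 1 + int ((x + i - 1) mod p)"
      "h = dec b k j t" "1 \<le> j" "2 * j \<le> b"
      "int t = (int p - 2) * (int j - 1) - 1 + int ((x + j - 1) mod p)"
      using dcE[OF gh(1)] dcE[OF gh(2)] by blast
    have "i \<noteq> j" using *(1,4,5,8) gh(3) by (metis of_nat_eq_iff)
    then show ?thesis using dd * by blast
  qed
  have CM: "P (cyc b) g" if "x = 1" "g \<in> MV p k x" for g
    using mvE[OF that(2)] cm that(1) by blast
  have CD: "P (cyc b) g" if "x = 1" "g \<in> DC p k x" for g
    using dcE[OF that(2)] cd that(1) by blast
  have "P g h"
  proof -
    have Qc: "(x = 1 \<and> g = cyc b) \<or> g \<in> MV p k x \<or> g \<in> DC p k x" if "g \<in> Q p k x" for g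
      using that unfolding Q_def b_def[symmetric] by (auto split: if_splits)
    show ?thesis
      using Qc[OF assms(3)] Qc[OF assms(4)] assms(5) MM MD DD CM CD sym by metis
  qed
  then show ?thesis unfolding P_def b_def .
qed

lemma compose_all_any_order:
  assumes "distinct fs" and "\<And>g h. g \<in> set fs \<Longrightarrow> h \<in> set fs \<Longrightarrow> g \<circ> h = h \<circ> g"
  shows "compose_all (set fs) = foldr (\<circ>) fs id"
proof -
  interpret comp_fun_commute_on "set fs" "(\<circ>)"
  proof
    fix g h assume "g \<in> set fs" "h \<in> set fs"
    then have "h \<circ> g = g \<circ> h" by (rule assms(2)[rotated])
    then show "(\<circ>) h \<circ> (\<circ>) g = (\<circ>) g \<circ> (\<circ>) h" by (auto simp: fun_eq_iff)
  qed
  have "Finite_Set.fold (\<circ>) id (set gs) = foldr (\<circ>) gs id"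
    if "set gs \<subseteq> set fs" "distinct gs" for gs
    using that by (induction gs) (auto simp: fold_insert)
  then show ?thesis using assms(1) unfolding compose_all_def by blast
qed

theorem Qmap_any_order:
  assumes "4 \<le> p" "p \<le> k" "distinct fs" "set fs = Q p k x"
  shows "Qmap p k x = foldr (\<circ>) fs id"
  unfolding Qmap_def assms(4)[symmetric]
proof (rule compose_all_any_order[OF assms(3)])
  fix g h assume "g \<in> set fs" "h \<in> set fs"
  then show "g \<circ> h = h \<circ> g"
    using Q_disjoint[OF assms(1,2), of g x h] acts_on_commute assms(4) by metis
qed

lemma finite_Q: "finite (Q p k x)"
proof -
  let ?b = "blk p k"
  have "MV p k x \<subseteq> mov ?b ` {j. real j \<le> (real k - 2) / (real p - 2)}"
    unfolding MV_def by blast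
  moreover have "{j. real j \<le> (real k - 2) / (real p - 2)}
      \<subseteq> {..nat \<lfloor>(real k - 2) / (real p - 2)\<rfloor>}"
    by (auto simp: le_nat_floor)
  ultimately have "finite (MV p k x)" by (meson finite_atMost finite_imageI finite_subset)
  moreover have "DC p k x \<subseteq> (\<lambda>(j, s). dec ?b k j s) ` ({..?b} \<times> {..k})"
    unfolding DC_def by force
  then have "finite (DC p k x)" by (rule finite_subset) simp
  ultimately show ?thesis unfolding Q_def by simp
qed

end

theory Submission
  imports Defs
begin

text \<open>
  Write \<open>b = 2 m\<close> and pair coordinate \<open>j\<close> with \<open>b - j + 1\<close>. A 2-flat sequence is almost balanced:
  its pair sums take only two consecutive integer values \<open>S\<close> and \<open>S + 1\<close>. All the maps are
  non-expansive in the supremum norm, so the orbit stays within \<open>1/4\<close> of the orbit of the real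
  sequence that has the same pair differences and all pair sums equal to \<open>S + 1/2\<close>.

  For a balanced sequence only the gaps \<open>d\<^sub>j = c\<^sub>j - c\<^bsub>b-j+1\<^esub>\<close> matter: \<open>cyc\<close> reflects \<open>d\<^sub>1\<close> at \<open>-1\<close>,
  \<open>dec\<^bsub>j,s\<^esub>\<close> reflects \<open>d\<^sub>j\<close> at \<open>h\<^sub>s\<close>, and \<open>mov\<^sub>j\<close> sorts \<open>d\<^sub>j, d\<^bsub>j+1\<^esub>\<close>. Gaps below \<open>-1\<close> run quickly to
  column 1, where they are reflected, and since \<open>h\<^bsub>s-1\<^esub> = 2 h\<^sub>s + 1\<close> the halving along the columns never
  creates new ones, so column \<open>j\<close> is free of them from round \<open>j - 1\<close> on. Afterwards each round
  makes the gap of column \<open>m\<close> nonpositive and shifts the set of positive gaps one column to the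
  right, so column \<open>j\<close> is settled in \<open>[-1, 0]\<close> from round \<open>m + j - 1\<close> on.

  By closeness and integrality, one half of the original sequence is then constant and the other one
  takes two values; the same shift keeps the settled columns of that half sorted.
\<close>

section \<open>Heights of the \<open>dec\<close> maps\<close>

lemma hgt_nonneg: "0 \<le> hgt k s"
  by (simp add: hgt_def)

lemma hgt_Suc: "Suc s < k \<Longrightarrow> hgt k s = 2 * hgt k (Suc s) + 1"
proof -
  assume "Suc s < k"
  then have "k - s - 1 = Suc (k - Suc s - 1)" by simp
  then show ?thesis by (simp add: hgt_def)
qed

lemma hgt_0: "k \<le> Suc s \<Longrightarrow> hgt k s = 0"
  by (simp add: hgt_def)

lemma hgt_antimono: "s \<le> t \<Longrightarrow> hgt k t \<le> hgt k s"
  by (auto simp: hgt_def intro!: power_increasing)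

lemma hgt_Ints: "hgt k s \<in> \<int>"
  by (simp add: hgt_def)

section \<open>Dynamics of the coordinate pairs\<close>

text \<open>\<open>U n j\<close> and \<open>V n j\<close> are the coordinates \<open>j\<close> and \<open>b - j + 1\<close> after \<open>n\<close> steps. The middle exchange
  \<open>mov\<^sub>m\<close> exists only if \<open>(p - 2) m = k - 2\<close>; it then has the form of \<open>dec\<^bsub>m,k-1\<^esub>\<close> (of height \<open>0\<close>) and is
  the case \<open>q = p\<close> of \<open>dec_col\<close>.\<close>

locale column_pairs =
  fixes p k m :: nat and U V :: "nat \<Rightarrow> nat \<Rightarrow> real"
  assumes p_ge: "4 \<le> p"
    and k_gt: "(p - 2) * (m - 1) + 2 < k"
    and k_le: "k \<le> (p - 2) * m + 2"
    and mov_fst: "\<lbrakk>1 \<le> j; j < m; (n + j) mod p = 0\<rbrakk> \<Longrightarrow>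
      U (Suc n) j = min (U n j) (U n (Suc j)) \<and> V (Suc n) j = max (V n j) (V n (Suc j))"
    and mov_snd: "\<lbrakk>1 \<le> j; j < m; (n + j) mod p = 0\<rbrakk> \<Longrightarrow>
      U (Suc n) (Suc j) = max (U n j) (U n (Suc j)) \<and> V (Suc n) (Suc j) = min (V n j) (V n (Suc j))"
    and cyc_1: "n mod p = 0 \<Longrightarrow>
      U (Suc n) 1 = max (U n 1) (V n 1 - 1) \<and> V (Suc n) 1 = min (U n 1 + 1) (V n 1)"
    and dec_col: "\<lbrakk>1 \<le> j; j \<le> m; 2 \<le> q; q < p \<or> q = p \<and> j = m; (n + j) mod p = q mod p;
        (p - 2) * (j - 1) + q \<le> k\<rbrakk> \<Longrightarrow>
      U (Suc n) j = min (U n j) (V n j + hgt k ((p - 2) * (j - 1) + q - 1)) \<and>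
      V (Suc n) j = max (U n j - hgt k ((p - 2) * (j - 1) + q - 1)) (V n j)"
    and idle: "\<lbrakk>1 \<le> j; j \<le> m; 2 \<le> q; q < p \<or> q = p \<and> j = m; (n + j) mod p = q mod p;
        k < (p - 2) * (j - 1) + q\<rbrakk> \<Longrightarrow> U (Suc n) j = U n j \<and> V (Suc n) j = V n j"
begin

lemma m_ge: "1 \<le> m"
  using k_gt k_le by (cases m) auto

text \<open>The residue of \<open>n + j\<close> decides: 0 is the left partner of an exchange, 1 the
  right partner or, in column 1, the place of \<open>cyc\<close>. Column \<open>m\<close> has no
  right neighbour, so its residue 0 is read as \<open>q = p\<close>.\<close>

lemma step_cases:
  assumes "1 \<le> j" "j \<le> m"
  obtains (fst) "j < m" "(n + j) mod p = 0"
  | (snd) i where "j = Suc i" "1 \<le> i" "i < m" "(n + i) mod p = 0"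
  | (cyc) "j = 1" "n mod p = 0"
  | (col) q where "2 \<le> q" "q < p \<or> q = p \<and> j = m" "(n + j) mod p = q mod p"
proof -
  have lt: "(n + j) mod p < p" using p_ge by simp
  consider "(n + j) mod p = 0" "j < m" | "(n + j) mod p = 0" "j = m" | "(n + j) mod p = 1" | "2 \<le> (n + j) mod p"
    using assms(2) by linarith
  then show thesis
  proof cases
    case 1 then show thesis using fst by simp
  next
    case 2 then show thesis using col[of p] p_ge by simp
  next
    case 3
    define i where "i = j - 1"
    have j: "j = Suc i" using assms unfolding i_def by simp
    have "(n + i) mod p = 0"
    proof -
      have "Suc (n + i) mod p = 1" using 3 j by simp
      then show ?thesis by (metis One_nat_def Suc_inject mod_Suc zero_neq_one)
    qed
    then show thesis using snd[of i] cyc j assms(2) by (cases "i = 0") auto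
  next
    case 4 then show thesis using col[of "(n + j) mod p"] lt by simp
  qed
qed

end

section \<open>Relations between two orbits\<close>

text \<open>Both systems apply the same map to the same columns at every step, so a relation between
  corresponding pairs need only survive each kind of map. Taking a system with itself gives
  invariants of one orbit.\<close>

lemma column_pairs_rel:
  assumes S: "column_pairs p k m U V" and T: "column_pairs p k m U' V'"
    and base: "\<And>j. 1 \<le> j \<Longrightarrow> j \<le> m \<Longrightarrow> P (U 0 j) (V 0 j) (U' 0 j) (V' 0 j)"
    and mov: "\<And>u v u' v' x y x' y'. P u v u' v' \<Longrightarrow> P x y x' y' \<Longrightarrow>
      P (min u x) (max v y) (min u' x') (max v' y') \<and> P (max u x) (min v y) (max u' x') (min v' y')"
    and cyc: "\<And>u v u' v'. P u v u' v' \<Longrightarrow>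
      P (max u (v - 1)) (min (u + 1) v) (max u' (v' - 1)) (min (u' + 1) v')"
    and dec: "\<And>u v u' v' s. P u v u' v' \<Longrightarrow>
      P (min u (v + hgt k s)) (max (u - hgt k s) v) (min u' (v' + hgt k s)) (max (u' - hgt k s) v')"
    and j: "1 \<le> j" "j \<le> m"
  shows "P (U n j) (V n j) (U' n j) (V' n j)"
  using j
proof (induction n arbitrary: j)
  case 0 then show ?case by (rule base)
next
  case (Suc n)
  interpret S: column_pairs p k m U V by (rule S)
  interpret T: column_pairs p k m U' V' by (rule T)
  show ?case
  proof (rule S.step_cases[OF Suc.prems, of n], goal_cases fst snd cyc col)
    case fst
    then show ?thesis
      using S.mov_fst[of j n] T.mov_fst[of j n] Suc mov[OF Suc.IH Suc.IH, of j "Suc j"] by simp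
  next
    case (snd i)
    then show ?thesis
      using S.mov_snd[of i n] T.mov_snd[of i n] Suc mov[OF Suc.IH Suc.IH, of i "Suc i"] by simp
  next
    case cyc': cyc
    then show ?thesis
      using S.cyc_1[of n] T.cyc_1[of n] Suc.prems cyc[OF Suc.IH, of 1] by simp
  next
    case (col q)
    show ?thesis
    proof (cases "(p - 2) * (j - 1) + q \<le> k")
      case True
      then show ?thesis
        using S.dec_col[OF Suc.prems col] T.dec_col[OF Suc.prems col] dec[OF Suc.IH, OF Suc.prems] by simp
    next
      case False
      then show ?thesis
        using S.idle[OF Suc.prems col] T.idle[OF Suc.prems col] Suc by simp
    qed
  qed
qed

lemma column_pairs_close:
  assumes S: "column_pairs p k m U V" and T: "column_pairs p k m U' V'"
    and "\<And>j. 1 \<le> j \<Longrightarrow> j \<le> m \<Longrightarrow> \<bar>U 0 j - U' 0 j\<bar> \<le> e \<and> \<bar>V 0 j - V' 0 j\<bar> \<le> e"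
    and j: "1 \<le> j" "j \<le> m"
  shows "\<bar>U n j - U' n j\<bar> \<le> e \<and> \<bar>V n j - V' n j\<bar> \<le> e"
  by (rule column_pairs_rel[OF S T _ _ _ _ j, where P = "\<lambda>u v u' v'. \<bar>u - u'\<bar> \<le> e \<and> \<bar>v - v'\<bar> \<le> e"])
    (use assms(3) in \<open>auto simp: min_def max_def\<close>)

lemma column_pairs_Ints:
  assumes S: "column_pairs p k m U V"
    and "\<And>j. 1 \<le> j \<Longrightarrow> j \<le> m \<Longrightarrow> U 0 j \<in> \<int> \<and> V 0 j \<in> \<int>"
    and j: "1 \<le> j" "j \<le> m"
  shows "U n j \<in> \<int> \<and> V n j \<in> \<int>"
  by (rule column_pairs_rel[OF S S _ _ _ _ j, where P = "\<lambda>u v _ _. u \<in> \<int> \<and> v \<in> \<int>"])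
    (use assms(2) hgt_Ints in \<open>auto simp: min_def max_def\<close>)

text \<open>This symmetry lets an even minimal pair sum be treated like an odd one.\<close>

lemma column_pairs_uminus:
  assumes "column_pairs p k m U V"
  shows "column_pairs p k m (\<lambda>n j. - V n j) (\<lambda>n j. - U n j)"
proof -
  interpret column_pairs p k m U V by (rule assms)
  show ?thesis
  proof
    fix j n assume "1 \<le> j" "j < m" "(n + j) mod p = 0"
    then show "- V (Suc n) j = min (- V n j) (- V n (Suc j)) \<and> - U (Suc n) j = max (- U n j) (- U n (Suc j))"
      and "- V (Suc n) (Suc j) = max (- V n j) (- V n (Suc j)) \<and> - U (Suc n) (Suc j) = min (- U n j) (- U n (Suc j))"
      using mov_fst[of j n] mov_snd[of j n] by auto
  next
    fix n assume "n mod p = 0"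
    then show "- V (Suc n) 1 = max (- V n 1) (- U n 1 - 1) \<and> - U (Suc n) 1 = min (- V n 1 + 1) (- U n 1)"
      using cyc_1[of n] by (auto simp: min_def max_def)
  next
    fix j q n assume "1 \<le> j" "j \<le> m" "2 \<le> q" "q < p \<or> q = p \<and> j = m" "(n + j) mod p = q mod p"
        "(p - 2) * (j - 1) + q \<le> k"
    from dec_col[OF this] show
      "- V (Suc n) j = min (- V n j) (- U n j + hgt k ((p - 2) * (j - 1) + q - 1)) \<and>
       - U (Suc n) j = max (- V n j - hgt k ((p - 2) * (j - 1) + q - 1)) (- U n j)"
      by (auto simp: min_def max_def)
  qed (use p_ge k_gt k_le idle in auto)
qed

section \<open>Local time\<close>

text \<open>Column \<open>j\<close> lags behind column \<open>j + 1\<close> by one step. In the local time \<open>n + j = p * a + q\<close>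
  with \<open>2 \<le> q \<le> p + 1\<close>, round \<open>a\<close> of every column consists of the \<open>dec\<close> steps up to \<open>q = p\<close>,
  followed by the two exchanges with its neighbours. The state exists only if \<open>j \<le> p * a + q\<close>.\<close>

definition loc :: "nat \<Rightarrow> (nat \<Rightarrow> nat \<Rightarrow> 'a) \<Rightarrow> nat \<Rightarrow> nat \<Rightarrow> nat \<Rightarrow> 'a" where
  "loc p u a q j = u (p * a + q - j) j"

context column_pairs
begin

text \<open>The exchange is one global step, but it takes column \<open>j\<close> to phase
  \<open>p + 1\<close> of round \<open>a\<close> and column \<open>j + 1\<close> to the start of
  round \<open>a + 1\<close>.\<close>

lemma loc_mov:
  assumes "1 \<le> j" "j < m" "j \<le> p * a + p"
  shows "loc p U a (Suc p) j = min (loc p U a p j) (loc p U a (Suc p) (Suc j))"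
    and "loc p U (Suc a) 2 (Suc j) = max (loc p U a p j) (loc p U a (Suc p) (Suc j))"
    and "loc p V a (Suc p) j = max (loc p V a p j) (loc p V a (Suc p) (Suc j))"
    and "loc p V (Suc a) 2 (Suc j) = min (loc p V a p j) (loc p V a (Suc p) (Suc j))"
proof -
  define n where "n = p * a + p - j"
  have n: "p * a + Suc p - j = Suc n" "p * Suc a + 2 - Suc j = Suc n" "p * a + Suc p - Suc j = n"
    using assms(3) unfolding n_def by auto
  have "n + j = p * (a + 1)" using assms(3) unfolding n_def by simp
  then have "(n + j) mod p = 0" by simp
  from mov_fst[OF assms(1,2) this] mov_snd[OF assms(1,2) this]
  show "loc p U a (Suc p) j = min (loc p U a p j) (loc p U a (Suc p) (Suc j))"
    "loc p U (Suc a) 2 (Suc j) = max (loc p U a p j) (loc p U a (Suc p) (Suc j))"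
    "loc p V a (Suc p) j = max (loc p V a p j) (loc p V a (Suc p) (Suc j))"
    "loc p V (Suc a) 2 (Suc j) = min (loc p V a p j) (loc p V a (Suc p) (Suc j))"
    unfolding loc_def n by (simp_all flip: n_def)
qed

lemma loc_cyc:
  "loc p U (Suc a) 2 1 = max (loc p U a (Suc p) 1) (loc p V a (Suc p) 1 - 1)"
  "loc p V (Suc a) 2 1 = min (loc p U a (Suc p) 1 + 1) (loc p V a (Suc p) 1)"
  using cyc_1[of "p * Suc a"] by (simp_all add: loc_def ac_simps)

lemma loc_col:
  assumes "1 \<le> j" "j \<le> m" "2 \<le> q" "q < p \<or> q = p \<and> j = m" "j \<le> p * a + q"
  shows "(p - 2) * (j - 1) + q \<le> k \<Longrightarrow> loc p U a (Suc q) j =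
      min (loc p U a q j) (loc p V a q j + hgt k ((p - 2) * (j - 1) + q - 1))"
    and "(p - 2) * (j - 1) + q \<le> k \<Longrightarrow> loc p V a (Suc q) j =
      max (loc p U a q j - hgt k ((p - 2) * (j - 1) + q - 1)) (loc p V a q j)"
    and "k < (p - 2) * (j - 1) + q \<Longrightarrow> loc p U a (Suc q) j = loc p U a q j"
    and "k < (p - 2) * (j - 1) + q \<Longrightarrow> loc p V a (Suc q) j = loc p V a q j"
proof -
  define n where "n = p * a + q - j"
  have n: "p * a + Suc q - j = Suc n" using assms(5) unfolding n_def by auto
  have "n + j = p * a + q" using assms(5) unfolding n_def by simp
  then have "(n + j) mod p = q mod p" by simp
  note * = dec_col[OF assms(1-4) this] idle[OF assms(1-4) this]
  show "(p - 2) * (j - 1) + q \<le> k \<Longrightarrow> loc p U a (Suc q) j =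
      min (loc p U a q j) (loc p V a q j + hgt k ((p - 2) * (j - 1) + q - 1))"
    "(p - 2) * (j - 1) + q \<le> k \<Longrightarrow> loc p V a (Suc q) j =
      max (loc p U a q j - hgt k ((p - 2) * (j - 1) + q - 1)) (loc p V a q j)"
    "k < (p - 2) * (j - 1) + q \<Longrightarrow> loc p U a (Suc q) j = loc p U a q j"
    "k < (p - 2) * (j - 1) + q \<Longrightarrow> loc p V a (Suc q) j = loc p V a q j"
    using * unfolding loc_def n n_def[symmetric] by simp_all
qed

end

section \<open>Gaps of balanced sequences\<close>

locale balanced_pairs = column_pairs +
  fixes \<sigma> :: real
  assumes sum_0: "\<lbrakk>1 \<le> j; j \<le> m\<rbrakk> \<Longrightarrow> U 0 j + V 0 j = \<sigma>"
    and diff_0: "\<lbrakk>1 \<le> j; j \<le> m\<rbrakk> \<Longrightarrow> \<bar>U 0 j - V 0 j\<bar> \<le> hgt k 0"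
begin

lemma sum_diff:
  assumes "1 \<le> j" "j \<le> m"
  shows "U n j + V n j = \<sigma> \<and> \<bar>U n j - V n j\<bar> \<le> hgt k 0"
  using column_pairs_axioms column_pairs_axioms _ _ _ _ assms
proof (rule column_pairs_rel[where P = "\<lambda>u v _ _. u + v = \<sigma> \<and> \<bar>u - v\<bar> \<le> hgt k 0"])
  fix u v s assume "u + v = \<sigma> \<and> \<bar>u - v\<bar> \<le> hgt k 0"
  then show "min u (v + hgt k s) + max (u - hgt k s) v = \<sigma> \<and>
      \<bar>min u (v + hgt k s) - max (u - hgt k s) v\<bar> \<le> hgt k 0"
    using hgt_nonneg[of k s] by (auto simp: min_def max_def)
qed (use sum_0 diff_0 in \<open>auto simp: min_def max_def\<close>)

definition gap :: "nat \<Rightarrow> nat \<Rightarrow> nat \<Rightarrow> real" where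
  "gap a q j = loc p U a q j - loc p V a q j"

lemma loc_sum: "1 \<le> j \<Longrightarrow> j \<le> m \<Longrightarrow> loc p U a q j + loc p V a q j = \<sigma>"
  using sum_diff unfolding loc_def by blast

text \<open>As both pairs have sum \<open>\<sigma>\<close>, a larger \<open>U\<close> goes with a
  smaller \<open>V\<close>; so the exchanges of both halves agree and sort the gaps.\<close>

lemma gap_mov:
  assumes "1 \<le> j" "j < m" "j \<le> p * a + p"
  shows "gap a (Suc p) j = min (gap a p j) (gap a (Suc p) (Suc j))"
    and "gap (Suc a) 2 (Suc j) = max (gap a p j) (gap a (Suc p) (Suc j))"
  using loc_mov[OF assms] loc_sum[of j a p] loc_sum[of "Suc j" a "Suc p"] assms
  unfolding gap_def by (auto simp: min_def max_def)

lemma gap_cyc: "gap (Suc a) 2 1 = max (gap a (Suc p) 1) (- 2 - gap a (Suc p) 1)"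
  unfolding gap_def loc_cyc by (auto simp: min_def max_def)

text \<open>Phase 2 of round 0 in column 1 is global time 1, just after the first
  \<open>cyc\<close>.\<close>

lemma gap_start_ge: "- 1 \<le> gap 0 2 1"
  using cyc_1[of 0] unfolding gap_def loc_def by (auto simp: min_def max_def)

lemma gap_le: "1 \<le> j \<Longrightarrow> j \<le> m \<Longrightarrow> gap a q j \<le> hgt k 0"
  using sum_diff[of j "p * a + q - j"] unfolding gap_def loc_def by linarith

lemma gap_dec:
  assumes "1 \<le> j" "j \<le> m" "2 \<le> q" "q < p \<or> q = p \<and> j = m" "j \<le> p * a + q"
    and "(p - 2) * (j - 1) + q \<le> k"
  shows "gap a (Suc q) j = min (gap a q j) (2 * hgt k ((p - 2) * (j - 1) + q - 1) - gap a q j)"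
  unfolding gap_def loc_col(1,2)[OF assms] by (auto simp: min_def max_def)

lemma gap_idle:
  assumes "1 \<le> j" "j \<le> m" "2 \<le> q" "q < p \<or> q = p \<and> j = m" "j \<le> p * a + q"
    and "k < (p - 2) * (j - 1) + q"
  shows "gap a (Suc q) j = gap a q j"
  unfolding gap_def loc_col(3,4)[OF assms] ..

text \<open>A \<open>dec\<close> step of height \<open>h\<close> turns a gap \<open>d\<close> into
  \<open>min d (2 * h - d)\<close>, which is at most \<open>d\<close> and at most \<open>h\<close>.
  The preceding cap is \<open>2 * h + 1\<close>, so a gap obeying it is not reflected below
  \<open>-1\<close>.\<close>

lemma gap_run:
  assumes j: "1 \<le> j" "j \<le> m" "j \<le> p * a + 2" and q: "2 \<le> q" "q \<le> p \<or> q = Suc p \<and> j = m"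
  shows gap_run_le: "gap a q j \<le> gap a 2 j"
    and gap_run_le_hgt: "3 \<le> q \<Longrightarrow> gap a q j \<le> hgt k ((p - 2) * (j - 1) + q - 2)"
    and gap_run_ge: "- 1 \<le> gap a 2 j \<Longrightarrow> gap a 2 j \<le> hgt k ((p - 2) * (j - 1)) \<Longrightarrow> - 1 \<le> gap a q j"
proof -
  have "gap a q j \<le> gap a 2 j \<and>
    (3 \<le> q \<longrightarrow> gap a q j \<le> hgt k ((p - 2) * (j - 1) + q - 2)) \<and>
    (- 1 \<le> gap a 2 j \<and> gap a 2 j \<le> hgt k ((p - 2) * (j - 1)) \<longrightarrow> - 1 \<le> gap a q j)"
    using q
  proof (induction q rule: dec_induct)
    case base
    then show ?case by simp
  next
    case (step q)
    \<comment> \<open>\<open>s\<close> indexes the cap in force before the step,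
      \<open>Suc s\<close> the height used by it. For \<open>q = 2\<close> the former is the cap
      assumed at the start of the round.\<close>
    define s where "s = (p - 2) * (j - 1) + q - 2"
    have s: "(p - 2) * (j - 1) + q - 1 = Suc s" "(p - 2) * (j - 1) + Suc q - 2 = Suc s"
      "(p - 2) * (j - 1) + q = s + 2" using step(1) unfolding s_def by auto
    have q': "q < p \<or> q = p \<and> j = m" "q \<le> p \<or> q = Suc p \<and> j = m" "j \<le> p * a + q"
      using step j by auto
    note IH = step.IH[OF q'(2), folded s_def]
    show ?case
    proof (cases "s + 2 \<le> k")
      case True
      have h: "hgt k s = 2 * hgt k (Suc s) + 1" using True by (intro hgt_Suc) simp
      have eq: "gap a (Suc q) j = min (gap a q j) (2 * hgt k (Suc s) - gap a q j)"
        using gap_dec[OF j(1,2) step(1) q'(1,3)] True unfolding s by simp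
      have q2: "q = 2 \<or> 3 \<le> q" using step(1) by linarith
      have "gap a q j \<le> hgt k s" if "gap a 2 j \<le> hgt k ((p - 2) * (j - 1))"
        using q2 IH that unfolding s_def by auto
      then show ?thesis using IH h unfolding s eq by (auto simp: min_def)
    next
      case False
      have eq: "gap a (Suc q) j = gap a q j"
        using gap_idle[OF j(1,2) step(1) q'(1,3)] False unfolding s by simp
      \<comment> \<open>Since \<open>(p - 2) * (m - 1) + 2 < k\<close>, every column has its
        \<open>dec\<close> at \<open>q = 2\<close>; idle steps come later, when the heights have
        reached 0.\<close>
      have "(p - 2) * (j - 1) \<le> (p - 2) * (m - 1)" using j(2) by (intro mult_left_mono) auto
      then have "3 \<le> q" using False k_gt unfolding s_def by linarith
      moreover have "hgt k s = 0" "hgt k (Suc s) = 0" using False by (auto intro!: hgt_0)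
      ultimately show ?thesis using IH unfolding s eq by auto
    qed
  qed
  then show "gap a q j \<le> gap a 2 j"
    "3 \<le> q \<Longrightarrow> gap a q j \<le> hgt k ((p - 2) * (j - 1) + q - 2)"
    "- 1 \<le> gap a 2 j \<Longrightarrow> gap a 2 j \<le> hgt k ((p - 2) * (j - 1)) \<Longrightarrow> - 1 \<le> gap a q j"
    by auto
qed

text \<open>The last cap of column \<open>j\<close> is the one with which column
  \<open>j + 1\<close> starts a round.\<close>

lemma gap_p_le:
  assumes "1 \<le> j" "j \<le> m" "j \<le> p * a + 2"
  shows "gap a p j \<le> hgt k ((p - 2) * j)"
proof -
  have "(p - 2) * (j - 1) + p - 2 = (p - 2) * j"
    using assms(1) p_ge by (cases j) auto
  then show ?thesis using gap_run_le_hgt[OF assms, of p] p_ge by simp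
qed

lemma gap_Suc_p_le:
  assumes "1 \<le> j" "j \<le> m" "j \<le> p * a + 2"
  shows "gap a (Suc p) j \<le> hgt k ((p - 2) * j)"
proof (cases "j = m")
  case True
  have "(p - 2) * (m - 1) + Suc p - 2 = Suc ((p - 2) * m)"
    using m_ge p_ge by (cases m) auto
  then have "gap a (Suc p) j \<le> hgt k (Suc ((p - 2) * m))"
    using gap_run_le_hgt[OF assms, of "Suc p"] p_ge True by simp
  also have "\<dots> \<le> hgt k ((p - 2) * m)" by (intro hgt_antimono) simp
  finally show ?thesis using True by simp
next
  case False
  then show ?thesis using gap_mov(1)[of j a] gap_p_le[OF assms] assms p_ge by simp
qed

lemma gap_2_le:
  assumes "1 \<le> j" "j \<le> m" "j \<le> Suc a"
  shows "gap a 2 j \<le> hgt k ((p - 2) * (j - 1))"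
proof (cases "j = 1")
  case True
  then show ?thesis using gap_le[of 1 a 2] assms by simp
next
  case False
  define i c where "i = j - 1" and "c = a - 1"
  have j: "j = Suc i" "a = Suc c" "1 \<le> i" "i < m" "i \<le> a"
    using False assms unfolding i_def c_def by auto
  \<comment> \<open>Keeps the subtraction in \<open>loc\<close> from truncating.\<close>
  have "1 * c \<le> p * c" using p_ge by (intro mult_right_mono) auto
  then have le: "Suc i \<le> p * c + 2" using j by linarith
  have "hgt k ((p - 2) * Suc i) \<le> hgt k ((p - 2) * i)" by (intro hgt_antimono) simp
  then show ?thesis
    using gap_mov(2)[of i c] gap_p_le[of i c] gap_Suc_p_le[of "Suc i" c] j le p_ge by simp
qed

text \<open>In column 1 the bound holds after each \<open>cyc\<close>. Column \<open>j + 1\<close>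
  starts a round with a maximum that includes the last gap of column \<open>j\<close>, and the caps
  preserve the bound through the round.\<close>

lemma gap_ge:
  assumes "1 \<le> j" "j \<le> m" "j \<le> Suc a" "2 \<le> q" "q \<le> p \<or> q = Suc p \<and> j = m"
  shows "- 1 \<le> gap a q j"
proof -
  have le: "j \<le> p * a + 2" if "j \<le> Suc a" for j a
  proof -
    have "1 * a \<le> p * a" using p_ge by (intro mult_right_mono) auto
    then show ?thesis using that by linarith
  qed
  have "- 1 \<le> gap a 2 j" if "1 \<le> j" "j \<le> m" "j \<le> Suc a" for a j
    using that
  proof (induction j arbitrary: a rule: dec_induct)
    case base
    show ?case
    proof (cases a)
      case 0 then show ?thesis using gap_start_ge by simp
    next
      case (Suc c) then show ?thesis using gap_cyc[of c] by (auto simp: max_def)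
    qed
  next
    case (step j)
    then obtain c where c: "a = Suc c" "j \<le> Suc c" by (cases a) auto
    have "- 1 \<le> gap c 2 j" using step c by auto
    then have "- 1 \<le> gap c p j"
      using gap_run_ge[of j c p] gap_2_le[of j c] step c le p_ge by auto
    then show ?case using gap_mov(2)[of j c] step c le[of j c] p_ge by auto
  qed
  from this[OF assms(1-3)] show ?thesis
    using gap_run_ge[OF assms(1,2) le[OF assms(3)] assms(4,5)] gap_2_le[OF assms(1-3)] by simp
qed

text \<open>At the end of its round column \<open>m\<close> has cap 0; the minima of the exchanges
  hand this bound leftwards within the same round.\<close>

lemma gap_Suc_p:
  assumes "1 \<le> j" "j \<le> m" "m \<le> Suc a"
  shows "- 1 \<le> gap a (Suc p) j \<and> gap a (Suc p) j \<le> 0"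
  using assms(2,1)
proof (induction j rule: inc_induct)
  case base
  have "1 * a \<le> p * a" using p_ge by (intro mult_right_mono) auto
  then have "m \<le> p * a + 2" using assms(3) by linarith
  then have "gap a (Suc p) m \<le> hgt k ((p - 2) * (m - 1) + Suc p - 2)"
    using gap_run_le_hgt[of m a "Suc p"] m_ge p_ge by auto
  also have "(p - 2) * (m - 1) + Suc p - 2 = Suc ((p - 2) * m)"
    using m_ge p_ge by (cases m) auto
  also have "hgt k (Suc ((p - 2) * m)) = 0" using k_le by (intro hgt_0) simp
  finally show ?case using gap_ge[of m a "Suc p"] assms(3) m_ge p_ge by simp
next
  case (step j)
  have "1 * a \<le> p * a" using p_ge by (intro mult_right_mono) auto
  then have "j \<le> p * a + p" using step(2) assms(3) p_ge by linarith
  then have "gap a (Suc p) j = min (gap a p j) (gap a (Suc p) (Suc j))"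
    using step by (intro gap_mov(1)) auto
  then show ?case using step gap_ge[of j a p] assms(3) p_ge by auto
qed

text \<open>From round \<open>m - 1\<close> on, \<open>cyc\<close> meets a gap in
  \<open>[-1, 0]\<close> and keeps it nonpositive. This spreads right by one column per round, as
  the right partner of each exchange is already nonpositive.\<close>

lemma gap_done:
  assumes "1 \<le> j" "j \<le> m" "m + j \<le> Suc a" "2 \<le> q" "q \<le> p"
  shows "gap a q j \<le> 0"
proof -
  have le: "j \<le> p * a + 2" if "m + j \<le> Suc a" for j a
  proof -
    have "1 * a \<le> p * a" using p_ge by (intro mult_right_mono) auto
    then show ?thesis using that by linarith
  qed
  have "gap a 2 j \<le> 0" if "1 \<le> j" "j \<le> m" "m + j \<le> Suc a" for a j
    using that
  proof (induction j arbitrary: a rule: dec_induct)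
    case base
    then obtain c where c: "a = Suc c" "m \<le> Suc c" using m_ge by (cases a) auto
    then show ?case using gap_cyc[of c] gap_Suc_p[of 1 c] m_ge by auto
  next
    case (step j)
    then obtain c where c: "a = Suc c" "m + j \<le> Suc c" by (cases a) auto
    have "gap c 2 j \<le> 0" using step c by auto
    then have "gap c p j \<le> 0"
      using gap_run_le[of j c p] step c le p_ge by force
    moreover have "gap c (Suc p) (Suc j) \<le> 0" using gap_Suc_p[of "Suc j" c] step c by auto
    ultimately show ?case using gap_mov(2)[of j c] step c le[of j c] p_ge by auto
  qed
  from this[OF assms(1-3)] show ?thesis
    using gap_run_le[OF assms(1,2) le[OF assms(3)] assms(4)] assms(5) by auto
qed

end

section \<open>Stationary patterns of marked columns\<close>

text \<open>\<open>X\<close>, \<open>Y\<close>, \<open>Z\<close> mark columns at the start of a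
  round, after its \<open>dec\<close> steps and after the exchange with the right neighbour; minima
  become conjunctions, maxima disjunctions. Column \<open>j\<close> can lose a mark to
  \<open>dec\<close> only before round \<open>m + j - 1\<close>; the exchanges push marks right
  until the pattern is sorted.\<close>

lemma rounds_stationary:
  fixes X Y Z :: "nat \<Rightarrow> nat \<Rightarrow> bool"
  assumes m: "1 \<le> m"
    and Z_rec: "\<And>a j. \<lbrakk>m \<le> a; 1 \<le> j; j < m\<rbrakk> \<Longrightarrow> Z a j \<longleftrightarrow> Y a j \<and> Z a (Suc j)"
    and X_rec: "\<And>a j. \<lbrakk>m \<le> a; 1 \<le> j; j < m\<rbrakk> \<Longrightarrow> X (Suc a) (Suc j) \<longleftrightarrow> Y a j \<or> Z a (Suc j)"
    and X_1: "\<And>a. m \<le> a \<Longrightarrow> X (Suc a) 1 \<longleftrightarrow> Z a 1"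
    and Z_m: "\<And>a. m \<le> a \<Longrightarrow> Z a m \<Longrightarrow> Y a m"
    and Y_X: "\<And>a j. \<lbrakk>m \<le> a; 1 \<le> j; j \<le> m; Y a j\<rbrakk> \<Longrightarrow> X a j"
    and X_Y: "\<And>a j. \<lbrakk>m + j \<le> Suc a; 1 \<le> j; j \<le> m; X a j\<rbrakk> \<Longrightarrow> Y a j"
    and Y_m: "\<And>a. 2 * m \<le> Suc a \<Longrightarrow> Y a m \<Longrightarrow> Z a m"
  shows "\<lbrakk>1 \<le> j; j < m; X (2 * m - 1) j\<rbrakk> \<Longrightarrow> X (2 * m - 1) (Suc j)"
    and "\<lbrakk>1 \<le> j; j \<le> m; 2 * m \<le> Suc a\<rbrakk> \<Longrightarrow> X a j \<longleftrightarrow> X (2 * m - 1) j"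
    and "\<lbrakk>1 \<le> j; j \<le> m; 2 * m \<le> Suc a\<rbrakk> \<Longrightarrow> Z a j \<longleftrightarrow> X (2 * m - 1) j"
proof -
  have Z_Y: "Z a j \<Longrightarrow> Y a j" if "m \<le> a" "1 \<le> j" "j \<le> m" for a j
    using that Z_rec[of a j] Z_m[of a] by (cases "j = m") auto
  \<comment> \<open>A mark of column \<open>j + 1\<close> comes from column \<open>j\<close> or
    \<open>j + 1\<close> of the previous round. Either way column \<open>j + 1\<close> was marked
    after its \<open>dec\<close> steps, so the exchange marks column \<open>j + 2\<close>.\<close>
  have sorted: "Y a j \<longrightarrow> Y a (Suc j)" if "1 \<le> j" "j < m" "m + j \<le> a" for a j
    using that
  proof (induction j arbitrary: a rule: dec_induct)
    case base
    then obtain c where c: "a = Suc c" "m \<le> c" by (cases a) auto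
    then show ?case
      using Y_X[of a 1] X_1[of c] Z_Y[of c 1] X_rec[of c 1] X_Y[of "Suc 1" a] base by auto
  next
    case (step j)
    then obtain c where c: "a = Suc c" "m + j \<le> c" by (cases a) auto
    then have "Y c j \<longrightarrow> Y c (Suc j)" using step by auto
    moreover have "Y a (Suc j) \<longrightarrow> Y c j \<or> Z c (Suc j)"
      using Y_X[of a "Suc j"] X_rec[of c j] c step by auto
    moreover have "Z c (Suc j) \<longrightarrow> Y c (Suc j)" using Z_Y[of c "Suc j"] c step by auto
    moreover have "Y c (Suc j) \<longrightarrow> Y a (Suc (Suc j))"
      using X_rec[of c "Suc j"] X_Y[of "Suc (Suc j)" a] c step by auto
    ultimately show ?case by blast
  qed
  have XY: "X a j \<longleftrightarrow> Y a j" if "2 * m \<le> Suc a" "1 \<le> j" "j \<le> m" for a j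
    using that X_Y[of j a] Y_X[of a j] by auto
  have sorted': "Y a j \<longrightarrow> Y a (Suc j)" if "2 * m \<le> Suc a" "1 \<le> j" "j < m" for a j
    using that by (intro sorted) auto
  \<comment> \<open>In a sorted pattern the conjunction in \<open>Z_rec\<close> collapses to
    \<open>Y a j\<close>.\<close>
  have ZY: "Z a j \<longleftrightarrow> Y a j" if "2 * m \<le> Suc a" "1 \<le> j" "j \<le> m" for a j
    using that(3,2)
  proof (induction j rule: inc_induct)
    case base
    then show ?case using Y_m[of a] Z_m[of a] that by auto
  next
    case (step j)
    then show ?case using Z_rec[of a j] sorted'[of a j] that by auto
  qed
  have X_Suc: "X (Suc a) j \<longleftrightarrow> X a j" if a: "2 * m \<le> Suc a" "1 \<le> j" "j \<le> m" for a j
  proof (cases "j = 1")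
    case True
    then show ?thesis using X_1[of a] ZY[of a 1] XY[of a 1] a by auto
  next
    case False
    then obtain i where "j = Suc i" "1 \<le> i" using a by (cases j) auto
    then show ?thesis using X_rec[of a i] ZY[of a j] XY[of a j] sorted'[of a i] a by auto
  qed
  show X: "X a j \<longleftrightarrow> X (2 * m - 1) j" if "1 \<le> j" "j \<le> m" "2 * m \<le> Suc a" for a j
  proof -
    have "2 * m - 1 \<le> a" using that by simp
    then show ?thesis
    proof (induction a rule: dec_induct)
      case (step a)
      then show ?case using X_Suc[of a j] that by auto
    qed simp
  qed
  show "Z a j \<longleftrightarrow> X (2 * m - 1) j" if "1 \<le> j" "j \<le> m" "2 * m \<le> Suc a" for a j
    using X[OF that] ZY[of a j] XY[of a j] that by simp
  show "X (2 * m - 1) (Suc j)" if "1 \<le> j" "j < m" "X (2 * m - 1) j"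
    using sorted'[of "2 * m - 1" j] XY[of "2 * m - 1"] that by auto
qed

section \<open>Single maps inside \<open>Qmap\<close>\<close>

lemma foldr_comp_unmoved:
  assumes "\<And>h c. h \<in> set hs \<Longrightarrow> h c t = c t"
  shows "foldr (\<circ>) hs g c t = g c t"
  using assms
proof (induction hs)
  case (Cons h hs)
  have "foldr (\<circ>) (h # hs) g c t = h (foldr (\<circ>) hs g c) t" by simp
  also have "\<dots> = foldr (\<circ>) hs g c t" by (rule Cons.prems) simp
  also have "\<dots> = g c t" using Cons by (meson list.set_intros(2))
  finally show ?case .
qed simp

text \<open>The witness \<open>c\<^sub>0\<close> puts \<open>t\<close> into the support of
  \<open>g\<close>. The other maps have supports disjoint from it, so at \<open>t\<close> only
  \<open>g\<close> acts.\<close>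

lemma Qmap_moved:
  assumes "4 \<le> p" "p \<le> k" "g \<in> Q p k x" "g c\<^sub>0 t \<noteq> c\<^sub>0 t"
  shows "Qmap p k x c t = g c t"
proof -
  obtain hs where hs: "set hs = Q p k x - {g}" "distinct hs"
    using finite_distinct_list[of "Q p k x - {g}"] finite_Q by auto
  have "Qmap p k x = foldr (\<circ>) (hs @ [g]) id"
    using hs assms by (intro Qmap_any_order) auto
  moreover have "h c t = c t" if "h \<in> set hs" for h c
  proof -
    have "h \<in> Q p k x" "g \<noteq> h" using that hs by auto
    then obtain A B where "acts_on g A" "acts_on h B" "A \<inter> B = {}"
      using Q_disjoint[OF assms(1-3)] by metis
    then show ?thesis using assms(4) unfolding acts_on_def by blast
  qed
  ultimately show ?thesis using foldr_comp_unmoved[of hs t g] by simp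
qed

lemma Qmap_unmoved:
  assumes "4 \<le> p" "p \<le> k" "\<And>g c. g \<in> Q p k x \<Longrightarrow> g c t = c t"
  shows "Qmap p k x c t = c t"
proof -
  obtain hs where hs: "set hs = Q p k x" "distinct hs"
    using finite_distinct_list[of "Q p k x"] finite_Q by auto
  have "Qmap p k x = foldr (\<circ>) hs id"
    using hs assms by (intro Qmap_any_order) auto
  then show ?thesis using foldr_comp_unmoved[of hs t id] hs assms(3) by simp
qed

lemma blk_bounds:
  assumes "4 \<le> p" "p \<le> k" "blk p k = 2 * m"
  shows "(p - 2) * (m - 1) + 2 < k" "k \<le> (p - 2) * m + 2"
proof -
  define r where "r = (real k - 2) / (real p - 2)"
  have m: "m = nat \<lceil>r\<rceil>" using assms(3) unfolding blk_def r_def by simp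
  have r0: "r > 0" unfolding r_def using assms by simp
  have r: "real k - 2 = real (p - 2) * r" unfolding r_def using assms by (simp add: of_nat_diff)
  have "r \<le> real m" using m by linarith
  then have "real (p - 2) * r \<le> real (p - 2) * real m" by (intro mult_left_mono) auto
  then have "real k \<le> real ((p - 2) * m + 2)" using r by simp
  then show "k \<le> (p - 2) * m + 2" by linarith
  have "real (m - 1) < r" using m r0 by linarith
  then have "real (p - 2) * real (m - 1) < real (p - 2) * r" using assms by (intro mult_strict_left_mono) auto
  then have "real ((p - 2) * (m - 1) + 2) < real k" using r by (simp only: of_nat_add of_nat_mult of_nat_numeral)
  then show "(p - 2) * (m - 1) + 2 < k" by linarith
qed

lemma le_ratio_iff:
  assumes "4 \<le> p" "p \<le> k"
  shows "real j \<le> (real k - 2) / (real p - 2) \<longleftrightarrow> (p - 2) * j + 2 \<le> k"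
proof -
  have "real j \<le> (real k - 2) / (real p - 2) \<longleftrightarrow> real j * (real p - 2) \<le> real k - 2"
    using assms by (simp add: pos_le_divide_eq)
  also have "\<dots> \<longleftrightarrow> real ((p - 2) * j + 2) \<le> real k"
    using assms by (simp add: of_nat_diff algebra_simps)
  finally show ?thesis by (simp only: of_nat_le_iff)
qed

text \<open>The \<open>n\<close>-th step (from \<open>0\<close>) applies \<open>Q\<^sub>x\<close> with \<open>x = n mod p + 1\<close>, so that \<open>x + j - 1 \<equiv> n + j\<close>.\<close>

context
  fixes p k m n :: nat
  assumes p: "4 \<le> p" "p \<le> k" and m: "blk p k = 2 * m"
begin

lemma x_mod: "(n mod p + 1 + j - 1) mod p = (n + j) mod p"
  by (simp add: mod_add_left_eq)

lemma x_cong_1: "[n mod p + 1 + j = 1] (mod p) \<longleftrightarrow> (n + j) mod p = 0"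
proof -
  have "[n mod p + 1 + j = 1] (mod p) \<longleftrightarrow> [n mod p + j = 0] (mod p)"
    using cong_add_rcancel_nat[of "n mod p + j" 1 0 p] by (simp add: ac_simps)
  then show ?thesis by (simp add: cong_def mod_add_left_eq)
qed

lemma x_mod_12: "(n mod p + 1 + j) mod p \<notin> {1, 2} \<longleftrightarrow> (n + j) mod p \<notin> {0, 1}"
proof -
  have "(n mod p + 1 + j) mod p = (n + j + 1) mod p"
    by (metis add.assoc add.commute mod_add_left_eq)
  also have "\<dots> = ((n + j) mod p + 1) mod p" by (simp add: mod_simps)
  finally have *: "(n mod p + 1 + j) mod p = ((n + j) mod p + 1) mod p" .
  have "(n + j) mod p < p" using p by simp
  then consider "(n + j) mod p + 1 < p" | "(n + j) mod p = p - 1" by linarith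
  then show ?thesis
  proof cases
    case 1 then show ?thesis unfolding * by auto
  next
    case 2 then show ?thesis unfolding * using p by auto
  qed
qed

lemma Q_cases:
  assumes "g \<in> Q p k (n mod p + 1)"
  obtains "n mod p = 0" "g = cyc (2 * m)"
  | j where "g = mov (2 * m) j" "1 \<le> j" "j \<le> m" "(p - 2) * j + 2 \<le> k" "(n + j) mod p = 0"
  | j s where "g = dec (2 * m) k j s" "1 \<le> j" "j \<le> m" "(n + j) mod p \<notin> {0, 1}"
      "s + 1 = (p - 2) * (j - 1) + (n + j) mod p" "s + 1 \<le> k"
proof -
  consider "n mod p = 0" "g = cyc (2 * m)" | "g \<in> MV p k (n mod p + 1)" | "g \<in> DC p k (n mod p + 1)"
    using assms unfolding Q_def m by (auto split: if_splits)
  then show thesis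
  proof cases
    case 2
    then obtain j where j: "g = mov (2 * m) j" "1 \<le> j" "real j \<le> (real k - 2) / (real p - 2)"
      "[n mod p + 1 + j = 1] (mod p)" unfolding MV_def m by blast
    have "j \<le> m" using blk_half[OF p j(3)] m by simp
    moreover have "(p - 2) * j + 2 \<le> k" using j(3) le_ratio_iff[OF p] by simp
    moreover have "(n + j) mod p = 0" using j(4) x_cong_1 by simp
    ultimately show thesis using that(2) j(1,2) by simp
  next
    case 3
    then obtain j s where j: "g = dec (2 * m) k j s" "1 \<le> j" "j \<le> m"
      "(n mod p + 1 + j) mod p \<notin> {1, 2}"
      "int s = (int p - 2) * (int j - 1) - 1 + int ((n mod p + 1 + j - 1) mod p)" "s \<le> k - 1"
      unfolding DC_def m by auto
    have "int (s + 1) = int ((p - 2) * (j - 1) + (n + j) mod p)"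
      using j(2,5) p unfolding x_mod by (simp add: of_nat_diff)
    then have "s + 1 = (p - 2) * (j - 1) + (n + j) mod p" by (simp only: of_nat_eq_iff)
    moreover have "(n + j) mod p \<notin> {0, 1}" using j(4) x_mod_12 by simp
    moreover have "s + 1 \<le> k" using j(6) p by linarith
    ultimately show thesis using that(3) j(1-3) by simp
  qed (use that(1) in simp)
qed

lemma mov_in_Q:
  assumes "1 \<le> j" "(p - 2) * j + 2 \<le> k" "(n + j) mod p = 0"
  shows "mov (2 * m) j \<in> Q p k (n mod p + 1)"
proof -
  have "real j \<le> (real k - 2) / (real p - 2)" using assms(2) le_ratio_iff[OF p] by simp
  moreover have "[n mod p + 1 + j = 1] (mod p)" using assms(3) x_cong_1 by simp
  ultimately show ?thesis using assms(1) unfolding Q_def MV_def m by blast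
qed

lemma dec_in_Q:
  assumes "1 \<le> j" "j \<le> m" "2 \<le> (n + j) mod p" "(p - 2) * (j - 1) + (n + j) mod p \<le> k"
  shows "dec (2 * m) k j ((p - 2) * (j - 1) + (n + j) mod p - 1) \<in> Q p k (n mod p + 1)"
proof -
  have "(n mod p + 1 + j) mod p \<notin> {1, 2}" using x_mod_12 assms(3) by auto
  moreover have "int ((p - 2) * (j - 1) + (n + j) mod p - 1)
      = (int p - 2) * (int j - 1) - 1 + int ((n mod p + 1 + j - 1) mod p)"
    using assms p unfolding x_mod by (simp add: of_nat_diff)
  moreover have "(p - 2) * (j - 1) + (n + j) mod p - 1 \<le> k - 1" using assms(4) by linarith
  ultimately show ?thesis using assms(1,2) unfolding Q_def DC_def m by force
qed

lemma Qmap_mov: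
  assumes "1 \<le> j" "j \<le> m" "(p - 2) * j + 2 \<le> k" "(n + j) mod p = 0" "t \<in> {j, Suc j, 2 * m - j, Suc (2 * m - j)}"
  shows "Qmap p k (n mod p + 1) c t = mov (2 * m) j c t"
proof -
  \<comment> \<open>A spike at \<open>t\<close>, positive where \<open>mov\<close> takes a minimum
    and negative where it takes a maximum, is flattened to 0.\<close>
  define c\<^sub>0 :: "nat \<Rightarrow> real" where "c\<^sub>0 = (\<lambda>u. if u = t then if t \<in> {j, 2 * m - j} then 1 else -1 else 0)"
  have "mov (2 * m) j c\<^sub>0 t \<noteq> c\<^sub>0 t" using assms unfolding mov_def c\<^sub>0_def by auto
  then show ?thesis using Qmap_moved[OF p mov_in_Q[OF assms(1,3,4)]] by blast
qed

lemma Qmap_dec: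
  assumes "1 \<le> j" "j \<le> m" "2 \<le> (n + j) mod p" "(p - 2) * (j - 1) + (n + j) mod p \<le> k"
    "t \<in> {j, Suc (2 * m - j)}"
  shows "Qmap p k (n mod p + 1) c t = dec (2 * m) k j ((p - 2) * (j - 1) + (n + j) mod p - 1) c t"
proof -
  define c\<^sub>0 :: "nat \<Rightarrow> real" where
    "c\<^sub>0 = (\<lambda>u. if u = j then hgt k ((p - 2) * (j - 1) + (n + j) mod p - 1) + 1 else 0)"
  have "dec (2 * m) k j ((p - 2) * (j - 1) + (n + j) mod p - 1) c\<^sub>0 t \<noteq> c\<^sub>0 t"
    using assms hgt_nonneg[of k "(p - 2) * (j - 1) + (n + j) mod p - 1"] unfolding dec_def c\<^sub>0_def by auto
  then show ?thesis using Qmap_moved[OF p dec_in_Q[OF assms(1-4)]] by blast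
qed

lemma Qmap_cyc:
  assumes "n mod p = 0" "t \<in> {1, 2 * m}" "1 \<le> m"
  shows "Qmap p k (n mod p + 1) c t = cyc (2 * m) c t"
proof -
  define c\<^sub>0 :: "nat \<Rightarrow> real" where "c\<^sub>0 = (\<lambda>u. if u = 2 * m then 2 else 0)"
  have "cyc (2 * m) \<in> Q p k (n mod p + 1)" using assms unfolding Q_def m by simp
  moreover have "cyc (2 * m) c\<^sub>0 t \<noteq> c\<^sub>0 t" using assms unfolding cyc_def c\<^sub>0_def by auto
  ultimately show ?thesis using Qmap_moved[OF p] by blast
qed

lemma Qmap_idle:
  assumes "1 \<le> j" "j \<le> m" "(n + j) mod p = 0 \<and> j = m \<and> k < (p - 2) * m + 2 \<or>
     2 \<le> (n + j) mod p \<and> k < (p - 2) * (j - 1) + (n + j) mod p"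
    and t: "t \<in> {j, Suc (2 * m - j)}"
  shows "Qmap p k (n mod p + 1) c t = c t"
proof (rule Qmap_unmoved[OF p])
  fix g c assume "g \<in> Q p k (n mod p + 1)"
  then show "g c t = c t"
  proof (cases rule: Q_cases)
    case 1
    \<comment> \<open>\<open>cyc\<close> occurs when column 1 has residue 1, which the hypothesis
      excludes.\<close>
    have "(n + j) mod p \<noteq> 1 mod p" using assms(3) p by auto
    then have "j \<noteq> 1" using 1 by (auto simp flip: mod_add_left_eq)
    then show ?thesis using 1 t assms(1,2) unfolding cyc_def by auto
  next
    case (2 i)
    have "(n + (i + 1)) mod p = 1"
      using 2(5) p by (metis add.assoc add_0 mod_add_left_eq mod_less one_less_numeral_iff order_less_le_trans semiring_norm(76))
    then have "j \<noteq> i" "j \<noteq> i + 1" using assms(3) 2 by auto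
    then show ?thesis using 2 t assms(1,2) unfolding mov_def by auto
  next
    case (3 i s)
    then have "j \<noteq> i" using assms(3) by auto
    then have "t \<noteq> i" "t \<noteq> 2 * m - i + 1" using 3(2,3) t assms(1,2) by auto
    then show ?thesis unfolding 3(1) dec_def by simp
  qed
qed

end

section \<open>Integer sequences near a balanced one\<close>

lemma Ints_le_if_less: "x \<in> \<int> \<Longrightarrow> y \<in> \<int> \<Longrightarrow> x < y + 1 \<Longrightarrow> x \<le> (y :: real)"
  by (auto elim!: Ints_cases)

text \<open>A balanced pair is \<open>v + 3 / 4\<close> plus and minus half its gap. For gaps in
  \<open>[-1, 0]\<close> closeness puts \<open>U\<close> into \<open>[v, v + 1]\<close> and
  \<open>V\<close> into \<open>[v + 1 / 2, v + 3 / 2]\<close>, so integrality forces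
  \<open>V = v + 1\<close>. It remains to sort the values of \<open>U\<close>.\<close>

lemma odd_sums_sorted:
  fixes v :: real
  assumes S: "column_pairs p k m U V" and T: "balanced_pairs p k m U' V' (2 * v + 3 / 2)"
    and v: "v \<in> \<int>"
    and ints: "\<And>j. 1 \<le> j \<Longrightarrow> j \<le> m \<Longrightarrow> U 0 j \<in> \<int> \<and> V 0 j \<in> \<int>"
    and close: "\<And>j. 1 \<le> j \<Longrightarrow> j \<le> m \<Longrightarrow> \<bar>U 0 j - U' 0 j\<bar> \<le> 1 / 4 \<and> \<bar>V 0 j - V' 0 j\<bar> \<le> 1 / 4"
    and D: "D = p * (2 * m - 1)"
  shows "\<lbrakk>1 \<le> j; j \<le> m\<rbrakk> \<Longrightarrow> v \<le> U D j \<and> U D j \<le> v + 1 \<and> V D j = v + 1"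
    and "\<lbrakk>1 \<le> j; j < m\<rbrakk> \<Longrightarrow> U D j \<le> U D (Suc j)"
proof -
  interpret S: column_pairs p k m U V by (rule S)
  interpret T: balanced_pairs p k m U' V' "2 * v + 3 / 2" by (rule T)
  have v1: "v + 1 \<in> \<int>" using v by auto
  have int_U: "loc p U a q j \<in> \<int>" and int_V: "loc p V a q j \<in> \<int>" if "1 \<le> j" "j \<le> m" for a q j
    using column_pairs_Ints[OF S ints that] unfolding loc_def by auto
  have near: "2 * v + 1 + T.gap a q j \<le> 2 * loc p U a q j" "2 * loc p U a q j \<le> 2 * v + 2 + T.gap a q j"
    "2 * v + 1 - T.gap a q j \<le> 2 * loc p V a q j" "2 * loc p V a q j \<le> 2 * v + 2 - T.gap a q j"
    if "1 \<le> j" "j \<le> m" for a q j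
    using column_pairs_close[OF S T.column_pairs_axioms close that, of "p * a + q - j"]
      T.loc_sum[OF that, of a q] unfolding T.gap_def loc_def by linarith+
  have lo: "v \<le> loc p U a q j" "loc p V a q j \<le> v + 1"
    if "1 \<le> j" "j \<le> m" "- 1 \<le> T.gap a q j" for a q j
  proof -
    have "v < loc p U a q j + 1" using near(1,2)[OF that(1,2), where a = a and q = q] that(3) by linarith
    then show "v \<le> loc p U a q j" using v int_U[OF that(1,2)] by (intro Ints_le_if_less)
    have "loc p V a q j < v + 1 + 1" using near(3,4)[OF that(1,2), where a = a and q = q] that(3) by linarith
    then show "loc p V a q j \<le> v + 1" using v1 int_V[OF that(1,2)] by (intro Ints_le_if_less)
  qed
  have hi: "loc p U a q j \<le> v + 1" "v + 1 \<le> loc p V a q j"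
    if "1 \<le> j" "j \<le> m" "T.gap a q j \<le> 0" for a q j
  proof -
    have "loc p U a q j < v + 1 + 1" using near(1,2)[OF that(1,2), where a = a and q = q] that(3) by linarith
    then show "loc p U a q j \<le> v + 1" using v1 int_U[OF that(1,2)] by (intro Ints_le_if_less)
    have "v + 1 < loc p V a q j + 1" using near(3,4)[OF that(1,2), where a = a and q = q] that(3) by linarith
    then show "v + 1 \<le> loc p V a q j" using v1 int_V[OF that(1,2)] by (intro Ints_le_if_less)
  qed
  \<comment> \<open>Marks the large values of \<open>U\<close>; phases 2, \<open>p\<close> and
    \<open>p + 1\<close> become \<open>X\<close>, \<open>Y\<close> and \<open>Z\<close> of
    \<open>rounds_stationary\<close>.\<close>
  define W where "W a q j \<longleftrightarrow> v + 1 \<le> loc p U a q j" for a q j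
  have le: "j \<le> p * a + q" if "j \<le> m" "m \<le> Suc a" "2 \<le> q" for j a q
  proof -
    have "1 * a \<le> p * a" using S.p_ge by (intro mult_right_mono) auto
    then show ?thesis using that by linarith
  qed
  have W_Suc: "W a (Suc q) j \<Longrightarrow> W a q j"
    if "m \<le> a" "1 \<le> j" "j \<le> m" "2 \<le> q" "q < p \<or> q = p \<and> j = m" for a q j
    using S.loc_col(1,3)[OF that(2-5) le, of a] that unfolding W_def
    by (cases "(p - 2) * (j - 1) + q \<le> k") auto
  \<comment> \<open>With \<open>v + 1 \<le> V\<close> the minimum taken by \<open>dec\<close> cannot
    push a marked \<open>U\<close> below \<open>v + 1\<close>.\<close>
  have Suc_W: "W a (Suc q) j"
    if "m + j \<le> Suc a" "1 \<le> j" "j \<le> m" "2 \<le> q" "q < p \<or> q = p \<and> j = m" "W a q j" for a q j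
  proof -
    have "v + 1 \<le> loc p V a q j" using T.gap_done[of j a q] that by (intro hi(2)) auto
    then show ?thesis
      using S.loc_col(1,3)[OF that(2-5) le, of a] that hgt_nonneg[of k "(p - 2) * (j - 1) + q - 1"]
      unfolding W_def by (cases "(p - 2) * (j - 1) + q \<le> k") auto
  qed
  have W_2: "W a 2 j" if "2 \<le> q" "m \<le> a" "1 \<le> j" "j \<le> m" "q \<le> p" "W a q j" for a q j
    using that
  proof (induction q rule: dec_induct)
    case (step q)
    then show ?case using W_Suc[of a j q] by auto
  qed
  have W_q: "W a q j" if "2 \<le> q" "m + j \<le> Suc a" "1 \<le> j" "j \<le> m" "q \<le> p" "W a 2 j" for a q j
    using that
  proof (induction q rule: dec_induct)
    case (step q)
    then show ?case using Suc_W[of j a q] by auto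
  qed
  have Z_rec: "W a (Suc p) j \<longleftrightarrow> W a p j \<and> W a (Suc p) (Suc j)"
    and X_rec: "W (Suc a) 2 (Suc j) \<longleftrightarrow> W a p j \<or> W a (Suc p) (Suc j)"
    if "m \<le> a" "1 \<le> j" "j < m" for a j
    using S.loc_mov(1,2)[of j a] that le[of j a p] S.p_ge unfolding W_def by (auto simp: le_max_iff_disj)
  \<comment> \<open>\<open>V - 1 \<le> v\<close>, so the maximum taken by \<open>cyc\<close> creates
    no mark.\<close>
  have X_1: "W (Suc a) 2 1 \<longleftrightarrow> W a (Suc p) 1" if "m \<le> a" for a
  proof -
    have "loc p V a (Suc p) 1 \<le> v + 1"
      using T.gap_Suc_p[of 1 a] that S.m_ge by (intro lo(2)) auto
    then show ?thesis unfolding W_def S.loc_cyc by auto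
  qed
  have Z_m: "W a (Suc p) m \<Longrightarrow> W a p m" if "m \<le> a" for a
    using W_Suc[of a m p] that S.m_ge S.p_ge by simp
  have Y_X: "W a p j \<Longrightarrow> W a 2 j" if "m \<le> a" "1 \<le> j" "j \<le> m" for a j
    using W_2[of p a j] that S.p_ge by simp
  have X_Y: "W a 2 j \<Longrightarrow> W a p j" if "m + j \<le> Suc a" "1 \<le> j" "j \<le> m" for a j
    using W_q[of p j a] that S.p_ge by simp
  have Y_m: "W a p m \<Longrightarrow> W a (Suc p) m" if "2 * m \<le> Suc a" for a
    using Suc_W[of m a p] that S.m_ge S.p_ge by simp
  have sorted: "W (2 * m - 1) 2 (Suc j)" if "1 \<le> j" "j < m" "W (2 * m - 1) 2 j" for j
    by (rule rounds_stationary(1)[where X = "\<lambda>a. W a 2" and Y = "\<lambda>a. W a p" and Z = "\<lambda>a. W a (Suc p)"])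
      (fact S.m_ge Z_rec X_rec X_1 Z_m Y_X X_Y Y_m that)+
  have X_stat: "W a 2 j \<longleftrightarrow> W (2 * m - 1) 2 j" if "1 \<le> j" "j \<le> m" "2 * m \<le> Suc a" for a j
    by (rule rounds_stationary(2)[where X = "\<lambda>a. W a 2" and Y = "\<lambda>a. W a p" and Z = "\<lambda>a. W a (Suc p)"])
      (fact S.m_ge Z_rec X_rec X_1 Z_m Y_X X_Y Y_m that)+
  have Z_stat: "W a (Suc p) j \<longleftrightarrow> W (2 * m - 1) 2 j" if "1 \<le> j" "j \<le> m" "2 * m \<le> Suc a" for a j
    by (rule rounds_stationary(3)[where X = "\<lambda>a. W a 2" and Y = "\<lambda>a. W a p" and Z = "\<lambda>a. W a (Suc p)"])
      (fact S.m_ge Z_rec X_rec X_1 Z_m Y_X X_Y Y_m that)+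
  \<comment> \<open>Time \<open>D\<close> in local time: columns \<open>j \<ge> 2\<close> are in
    round \<open>2 * m - 1\<close> or later, while column 1 is at the last phase of round
    \<open>2 * m - 2\<close>, just before \<open>cyc\<close>.\<close>
  have at_D: "\<exists>a q. (\<forall>u :: nat \<Rightarrow> nat \<Rightarrow> real. u D j = loc p u a q j) \<and>
      (2 \<le> q \<and> q \<le> Suc p \<and> 2 * m \<le> Suc a \<or> q = Suc p \<and> j = 1 \<and> Suc a = 2 * m - 1)"
    if "1 \<le> j" "j \<le> m" for j
  proof (cases "j = 1")
    case True
    have "2 * m - 1 = Suc (2 * m - 2)" using S.m_ge by simp
    then have "p * (2 * m - 2) + Suc p - 1 = D" unfolding D by simp
    then show ?thesis using True S.m_ge unfolding loc_def
      by (intro exI[of _ "2 * m - 2"] exI[of _ "Suc p"]) auto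
  next
    case False
    define a where "a = 2 * m - 1 + (j - 2) div p"
    define q where "q = (j - 2) mod p + 2"
    have "(j - 2) mod p < p" using S.p_ge by simp
    then have q: "2 \<le> q" "q \<le> Suc p" unfolding q_def by auto
    have "p * a + q = p * (2 * m - 1) + (p * ((j - 2) div p) + (j - 2) mod p) + 2"
      unfolding a_def q_def distrib_left by linarith
    also have "\<dots> = D + j" using False that unfolding D mult_div_mod_eq by linarith
    finally have "p * a + q - j = D" by simp
    then show ?thesis using q unfolding loc_def
      by (intro exI[of _ a] exI[of _ q]) (auto simp: a_def)
  qed
  have final: "v \<le> U D j \<and> U D j \<le> v + 1 \<and> V D j = v + 1" if j: "1 \<le> j" "j \<le> m" for j
  proof -
    obtain a q where aq: "\<And>u :: nat \<Rightarrow> nat \<Rightarrow> real. u D j = loc p u a q j"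
      "2 \<le> q \<and> q \<le> Suc p \<and> 2 * m \<le> Suc a \<or> q = Suc p \<and> j = 1 \<and> Suc a = 2 * m - 1"
      using at_D[OF j] by blast
    have "- 1 \<le> T.gap a q j \<and> T.gap a q j \<le> 0"
    proof (cases "q = Suc p")
      case True
      have "m \<le> Suc a" using aq(2) S.m_ge by auto
      then show ?thesis using T.gap_Suc_p[OF j] True by simp
    next
      case False
      then show ?thesis using T.gap_ge[OF j, of a q] T.gap_done[OF j, of a q] aq(2) j by auto
    qed
    then show ?thesis using lo[OF j, of a q] hi[OF j, of a q] unfolding aq(1) by auto
  qed
  \<comment> \<open>Column 1 reaches the stationary pattern through \<open>X_1\<close> in round
    \<open>2 * m - 2\<close>, which requires \<open>m \<le> 2 * m - 2\<close>.\<close>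
  have W_D: "v + 1 \<le> U D j \<longleftrightarrow> W (2 * m - 1) 2 j" if j: "1 \<le> j" "j \<le> m" "2 \<le> m" for j
  proof -
    obtain a q where aq: "\<And>u :: nat \<Rightarrow> nat \<Rightarrow> real. u D j = loc p u a q j"
      "2 \<le> q \<and> q \<le> Suc p \<and> 2 * m \<le> Suc a \<or> q = Suc p \<and> j = 1 \<and> Suc a = 2 * m - 1"
      using at_D[OF j(1,2)] by blast
    consider "2 * m \<le> Suc a" "q = Suc p" | "2 * m \<le> Suc a" "2 \<le> q" "q \<le> p" | "q = Suc p" "j = 1" "Suc a = 2 * m - 1"
      using aq(2) by linarith
    then have "W a q j \<longleftrightarrow> W (2 * m - 1) 2 j"
    proof cases
      case 1 then show ?thesis using Z_stat[OF j(1,2)] by simp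
    next
      case 2
      then have "m \<le> a" "m + j \<le> Suc a" using j by auto
      then show ?thesis
        using X_stat[OF j(1,2) 2(1)] W_2[OF 2(2) _ j(1,2) 2(3)] W_q[OF 2(2) _ j(1,2) 2(3)] by metis
    next
      case 3 then show ?thesis using X_1[of a] j(3) by simp
    qed
    then show ?thesis unfolding W_def aq(1) .
  qed
  show "v \<le> U D j \<and> U D j \<le> v + 1 \<and> V D j = v + 1" if "1 \<le> j" "j \<le> m" using final that .
  show "U D j \<le> U D (Suc j)" if j: "1 \<le> j" "j < m"
  proof (cases "v + 1 \<le> U D j")
    case True
    then have "v + 1 \<le> U D (Suc j)" using W_D[of j] W_D[of "Suc j"] sorted[OF j] j by auto
    then show ?thesis using final[of j] j by auto
  next
    case False
    have "U D j \<in> \<int>" using column_pairs_Ints[OF S ints] j by auto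
    then have "U D j \<le> v" using False v by (intro Ints_le_if_less) auto
    then show ?thesis using final[of "Suc j"] j by auto
  qed
qed

section \<open>Orbits as column pairs\<close>

primrec orbit :: "nat \<Rightarrow> nat \<Rightarrow> (nat \<Rightarrow> real) \<Rightarrow> nat \<Rightarrow> nat \<Rightarrow> real" where
  "orbit p k c 0 = c"
| "orbit p k c (Suc n) = Qmap p k (n mod p + 1) (orbit p k c n)"

lemma column_pairs_orbit:
  assumes p: "4 \<le> p" "p \<le> k" and m: "blk p k = 2 * m"
  shows "column_pairs p k m (orbit p k c) (\<lambda>n j. orbit p k c n (Suc (2 * m - j)))"
proof
  show "4 \<le> p" by (rule p)
  show k: "(p - 2) * (m - 1) + 2 < k" "k \<le> (p - 2) * m + 2" using blk_bounds[OF p m] .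
  have m1: "1 \<le> m" using k by (cases m) auto
  {
    fix j n assume j: "1 \<le> j" "j < m" "(n + j) mod p = 0"
    have "(p - 2) * j \<le> (p - 2) * (m - 1)" using j by (intro mult_left_mono) auto
    then have *: "(p - 2) * j + 2 \<le> k" using k by linarith
    note mv = Qmap_mov[OF p m j(1) _ * j(3), of _ "orbit p k c n"]
    have eq: "Suc (2 * m - Suc j) = 2 * m - j" using j by simp
    have ne: "Suc (2 * m - j) \<notin> {j, 2 * m - j}" "Suc j \<notin> {j, 2 * m - j}" using j by auto
    show "orbit p k c (Suc n) j = min (orbit p k c n j) (orbit p k c n (Suc j)) \<and>
      orbit p k c (Suc n) (Suc (2 * m - j)) =
        max (orbit p k c n (Suc (2 * m - j))) (orbit p k c n (Suc (2 * m - Suc j)))"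
      using mv[of j] mv[of "Suc (2 * m - j)"] j ne unfolding eq mov_def by (auto simp: max.commute)
    show "orbit p k c (Suc n) (Suc j) = max (orbit p k c n j) (orbit p k c n (Suc j)) \<and>
      orbit p k c (Suc n) (Suc (2 * m - Suc j)) =
        min (orbit p k c n (Suc (2 * m - j))) (orbit p k c n (Suc (2 * m - Suc j)))"
      using mv[of "Suc j"] mv[of "2 * m - j"] j ne unfolding eq mov_def by (auto simp: min.commute)
  }
  {
    fix n assume n: "n mod p = 0"
    have eq: "Suc (2 * m - 1) = 2 * m" using m1 by simp
    show "orbit p k c (Suc n) 1 = max (orbit p k c n 1) (orbit p k c n (Suc (2 * m - 1)) - 1) \<and>
      orbit p k c (Suc n) (Suc (2 * m - 1)) = min (orbit p k c n 1 + 1) (orbit p k c n (Suc (2 * m - 1)))"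
      using Qmap_cyc[OF p m n, of 1 "orbit p k c n"] Qmap_cyc[OF p m n, of "2 * m" "orbit p k c n"] m1
      unfolding eq cyc_def by auto
  }
  {
    fix j q n assume j: "1 \<le> j" "j \<le> m" "2 \<le> q" "q < p \<or> q = p \<and> j = m" "(n + j) mod p = q mod p"
      and le: "(p - 2) * (j - 1) + q \<le> k"
    show "orbit p k c (Suc n) j = min (orbit p k c n j)
          (orbit p k c n (Suc (2 * m - j)) + hgt k ((p - 2) * (j - 1) + q - 1)) \<and>
        orbit p k c (Suc n) (Suc (2 * m - j)) =
          max (orbit p k c n j - hgt k ((p - 2) * (j - 1) + q - 1)) (orbit p k c n (Suc (2 * m - j)))"
    proof (cases "q < p")
      case True
      then have q: "(n + j) mod p = q" using j by simp
      have ne: "Suc (2 * m - j) \<noteq> j" using j by linarith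
      show ?thesis
        using Qmap_dec[OF p m j(1,2), of n j "orbit p k c n"]
          Qmap_dec[OF p m j(1,2), of n "Suc (2 * m - j)" "orbit p k c n"] ne j(3) le
        unfolding q dec_def by auto
    next
      case False
      then have q: "q = p" "j = m" using j(4) by auto
      \<comment> \<open>By this identity \<open>le\<close> says that the middle exchange is present;
        the height index is then at least \<open>k - 1\<close>, so the height is 0.\<close>
      have "(p - 2) * (m - 1) + p = (p - 2) * m + 2" using m1 p by (cases m) auto
      then have *: "(p - 2) * m + 2 \<le> k" "k \<le> Suc ((p - 2) * (j - 1) + q - 1)" using le q k by auto
      have 0: "(n + m) mod p = 0" using j(5) q by simp
      have eq: "Suc (2 * m - m) = Suc m" by simp
      show ?thesis
        using Qmap_mov[OF p m m1 order.refl *(1) 0, of m "orbit p k c n"]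
          Qmap_mov[OF p m m1 order.refl *(1) 0, of "Suc m" "orbit p k c n"] m1
        unfolding hgt_0[OF *(2)] unfolding q eq mov_def by auto
    qed
  }
  {
    fix j q n assume j: "1 \<le> j" "j \<le> m" "2 \<le> q" "q < p \<or> q = p \<and> j = m" "(n + j) mod p = q mod p"
      and gt: "k < (p - 2) * (j - 1) + q"
    have "(n + j) mod p = 0 \<and> j = m \<and> k < (p - 2) * m + 2 \<or>
      2 \<le> (n + j) mod p \<and> k < (p - 2) * (j - 1) + (n + j) mod p"
    proof (cases "q < p")
      case False
      have "(p - 2) * (m - 1) + p = (p - 2) * m + 2" using m1 p by (cases m) auto
      then show ?thesis using False j gt by auto
    qed (use j gt in auto)
    from Qmap_idle[OF p m j(1,2) this]
    show "orbit p k c (Suc n) j = orbit p k c n j \<and>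
      orbit p k c (Suc n) (Suc (2 * m - j)) = orbit p k c n (Suc (2 * m - j))"
      by simp
  }
qed


section \<open>Flat sequences and the conclusion\<close>

lemma flat_mono:
  assumes "flat m a" "1 \<le> i" "i \<le> j" "j \<le> m"
  shows "a i \<le> a j"
  using assms(3,2,4)
proof (induction j rule: dec_induct)
  case (step j)
  then have "a j \<le> a (j + 1)" using assms(1) unfolding flat_def by auto
  then show ?case using step by simp
qed simp

lemma flat_spread:
  assumes "flat m a" "1 \<le> i" "i \<le> m" "1 \<le> j" "j \<le> m"
  shows "a j \<le> a i + 1"
proof -
  have "a j \<le> a m" "a 1 \<le> a i" "a m \<le> a 1 + 1"
    using flat_mono[OF assms(1)] assms unfolding flat_def by auto
  then show ?thesis by linarith
qed

text \<open>Paired positions have opposite parity, so each pair sum is some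
  \<open>A r + E (Suc m - r)\<close>. As \<open>r\<close> grows, \<open>A\<close> rises and
  \<open>E\<close> falls, each by at most 1.\<close>

lemma two_flat_sums:
  assumes "two_flat (2 * m) c" "1 \<le> i" "i \<le> m" "1 \<le> j" "j \<le> m"
  shows "c i + c (Suc (2 * m - i)) \<le> c j + c (Suc (2 * m - j)) + 1"
proof -
  define A E where "A = (\<lambda>i. c (2 * i - 1))" and "E = (\<lambda>i. c (2 * i))"
  have fl: "flat m A" "flat m E" using assms(1) unfolding two_flat_def A_def E_def by auto
  have ex: "\<exists>r. 1 \<le> r \<and> r \<le> m \<and> c i + c (Suc (2 * m - i)) = A r + E (Suc m - r)"
    if i: "1 \<le> i" "i \<le> m" for i
  proof (cases "even i")
    case True
    then obtain r where r: "i = 2 * r" by blast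
    have "2 * (Suc m - r) - 1 = Suc (2 * m - i)" "Suc m - (Suc m - r) = r" using r i by auto
    then have "A (Suc m - r) = c (Suc (2 * m - i))" "E (Suc m - (Suc m - r)) = c i"
      unfolding A_def E_def using r by auto
    then show ?thesis using r i by (intro exI[of _ "Suc m - r"]) auto
  next
    case False
    then obtain r where r: "i = 2 * r + 1" using oddE by blast
    have "2 * (Suc m - Suc r) = Suc (2 * m - i)" "2 * Suc r - 1 = i" using r i by auto
    then show ?thesis using r i unfolding A_def E_def by (intro exI[of _ "Suc r"]) auto
  qed
  obtain r where r: "1 \<le> r" "r \<le> m" "c i + c (Suc (2 * m - i)) = A r + E (Suc m - r)"
    using ex[OF assms(2,3)] by blast
  obtain s where s: "1 \<le> s" "s \<le> m" "c j + c (Suc (2 * m - j)) = A s + E (Suc m - s)"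
    using ex[OF assms(4,5)] by blast
  consider "r \<le> s" | "s \<le> r" by linarith
  then show ?thesis
  proof cases
    case 1
    then have "A r \<le> A s" using flat_mono[OF fl(1)] r s by simp
    moreover have "E (Suc m - r) \<le> E (Suc m - s) + 1" using r s by (intro flat_spread[OF fl(2)]) auto
    ultimately show ?thesis using r s by linarith
  next
    case 2
    then have "E (Suc m - r) \<le> E (Suc m - s)" using r s by (intro flat_mono[OF fl(2)]) auto
    moreover have "A r \<le> A s + 1" using r s by (intro flat_spread[OF fl(1)]) auto
    ultimately show ?thesis using r s by linarith
  qed
qed

lemma flat_of_halves:
  assumes "1 \<le> m"
    and "\<And>j. \<lbrakk>1 \<le> j; j < m\<rbrakk> \<Longrightarrow> c j \<le> c (Suc j)"
    and "\<And>j. \<lbrakk>1 \<le> j; j < m\<rbrakk> \<Longrightarrow> c (Suc (2 * m - Suc j)) \<le> c (Suc (2 * m - j))"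
    and "c m \<le> c (Suc m)" "c (2 * m) \<le> c 1 + 1"
  shows "flat (2 * m) c"
  unfolding flat_def
proof (intro conjI allI impI)
  fix i assume i: "1 \<le> i \<and> i < 2 * m"
  consider "i < m" | "i = m" | "m < i" by linarith
  then show "c i \<le> c (i + 1)"
  proof cases
    case 3
    then have "Suc (2 * m - Suc (2 * m - i)) = i" "Suc (2 * m - (2 * m - i)) = i + 1" using i by auto
    then show ?thesis using assms(3)[of "2 * m - i"] 3 i by simp
  qed (use assms(2)[of i] assms(4) i in auto)
qed (rule assms(5))

lemma orbit_flat:
  assumes p: "4 \<le> p" "p \<le> k" and m: "blk p k = 2 * m"
    and fl: "two_flat (2 * m) c"
    and c: "\<And>i. \<lbrakk>1 \<le> i; i \<le> 2 * m\<rbrakk> \<Longrightarrow> c i \<in> \<int> \<and> 0 \<le> c i \<and> c i \<le> 2 ^ (k - 1) - 1"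
  shows "flat (2 * m) (orbit p k c (p * (2 * m - 1)))"
proof -
  define D where "D = p * (2 * m - 1)"
  define S where "S = Min ((\<lambda>j. c j + c (Suc (2 * m - j))) ` {1..m})"
  have m1: "1 \<le> m" using blk_ge_2[OF p] m by simp
  have "S \<in> (\<lambda>j. c j + c (Suc (2 * m - j))) ` {1..m}"
    unfolding S_def using m1 by (intro Min_in) auto
  then obtain i where i: "1 \<le> i" "i \<le> m" "S = c i + c (Suc (2 * m - i))" by auto
  have ints: "c j \<in> \<int> \<and> c (Suc (2 * m - j)) \<in> \<int>" if "1 \<le> j" "j \<le> m" for j
    using c[of j] c[of "Suc (2 * m - j)"] that by auto
  have sums: "S \<le> c j + c (Suc (2 * m - j))" "c j + c (Suc (2 * m - j)) \<le> S + 1" if "1 \<le> j" "j \<le> m" for j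
  proof -
    show "S \<le> c j + c (Suc (2 * m - j))" unfolding S_def using that by (intro Min_le) auto
    show "c j + c (Suc (2 * m - j)) \<le> S + 1" using two_flat_sums[OF fl that i(1,2)] i(3) by simp
  qed
  have "S \<in> \<int>" using i ints by auto
  then obtain z where z: "S = of_int z" by (elim Ints_cases)
  \<comment> \<open>Both entries of a pair are shifted equally to bring the sum to
    \<open>S + 1 / 2\<close>; as the sum lies in \<open>[S, S + 1]\<close>, the shift is at most
    \<open>1 / 4\<close>.\<close>
  define e where "e t = c t + (S + 1 / 2 - (c t + c (Suc (2 * m - t)))) / 2" for t
  define U V where "U = orbit p k c" and "V = (\<lambda>n j. orbit p k c n (Suc (2 * m - j)))"
  define U' V' where "U' = orbit p k e" and "V' = (\<lambda>n j. orbit p k e n (Suc (2 * m - j)))"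
  have cp: "column_pairs p k m U V" "column_pairs p k m U' V'"
    unfolding U_def V_def U'_def V'_def by (intro column_pairs_orbit[OF p m])+
  have e: "e j + e (Suc (2 * m - j)) = S + 1 / 2"
    "e j - e (Suc (2 * m - j)) = c j - c (Suc (2 * m - j))"
    "\<bar>c j - e j\<bar> \<le> 1 / 4" "\<bar>c (Suc (2 * m - j)) - e (Suc (2 * m - j))\<bar> \<le> 1 / 4"
    if "1 \<le> j" "j \<le> m" for j
  proof -
    have "Suc (2 * m - Suc (2 * m - j)) = j" using that by simp
    then have *: "e (Suc (2 * m - j)) = c (Suc (2 * m - j)) + (S + 1 / 2 - (c j + c (Suc (2 * m - j)))) / 2"
      unfolding e_def by (simp add: add.commute)
    show "e j + e (Suc (2 * m - j)) = S + 1 / 2"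
      "e j - e (Suc (2 * m - j)) = c j - c (Suc (2 * m - j))"
      unfolding * e_def[of j] by (auto simp: field_simps)
    show "\<bar>c j - e j\<bar> \<le> 1 / 4" "\<bar>c (Suc (2 * m - j)) - e (Suc (2 * m - j))\<bar> \<le> 1 / 4"
      using sums[OF that] unfolding * e_def[of j] by (simp_all add: abs_le_iff field_simps)
  qed
  have d: "\<bar>c j - c (Suc (2 * m - j))\<bar> \<le> hgt k 0" if "1 \<le> j" "j \<le> m" for j
  proof -
    have "0 \<le> c j" "c j \<le> 2 ^ (k - 1) - 1" "0 \<le> c (Suc (2 * m - j))" "c (Suc (2 * m - j)) \<le> 2 ^ (k - 1) - 1"
      using c[of j] c[of "Suc (2 * m - j)"] that by auto
    then show ?thesis unfolding hgt_def by (simp add: abs_le_iff)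
  qed
  have bal: "balanced_pairs p k m U' V' (S + 1 / 2)"
    unfolding balanced_pairs_def balanced_pairs_axioms_def
    using cp(2) e d by (auto simp: U'_def V'_def)
  show ?thesis
  \<comment> \<open>For odd \<open>S\<close> the half \<open>V\<close> ends up constant; for even
    \<open>S\<close> it is \<open>U\<close>, as the negated system shows.\<close>
  proof (cases "even z")
    case False
    then obtain w where w: "z = 2 * w + 1" by (elim oddE)
    then have S: "S + 1 / 2 = 2 * of_int w + 3 / 2" using z by simp
    note * = odd_sums_sorted[OF cp(1) bal[unfolded S] Ints_of_int _ _ D_def]
    have 1: "of_int w \<le> U D j \<and> U D j \<le> of_int w + 1 \<and> V D j = of_int w + 1" if "1 \<le> j" "j \<le> m" for j
      using that ints e by (intro *(1)) (auto simp: U_def V_def U'_def V'_def)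
    have 2: "U D j \<le> U D (Suc j)" if "1 \<le> j" "j < m" for j
      using that ints e by (intro *(2)) (auto simp: U_def V_def U'_def V'_def)
    show ?thesis unfolding D_def[symmetric]
    proof (rule flat_of_halves[OF m1])
      fix j assume j: "1 \<le> j" "j < m"
      show "orbit p k c D j \<le> orbit p k c D (Suc j)" using 2[OF j] unfolding U_def .
      show "orbit p k c D (Suc (2 * m - Suc j)) \<le> orbit p k c D (Suc (2 * m - j))"
        using 1[of j] 1[of "Suc j"] j unfolding V_def by auto
    next
      show "orbit p k c D m \<le> orbit p k c D (Suc m)" "orbit p k c D (2 * m) \<le> orbit p k c D 1 + 1"
        using 1[of 1] 1[of m] m1 unfolding V_def U_def by auto
    qed
  next
    case True
    then obtain w where w: "z = 2 * w" by (elim evenE)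
    \<comment> \<open>Chosen so that \<open>- (2 * w + 1 / 2) = 2 * v + 3 / 2\<close>.\<close>
    define v where "v = - w - 1"
    have S: "- (S + 1 / 2) = 2 * of_int v + 3 / 2" using z w unfolding v_def by simp
    have bal': "balanced_pairs p k m (\<lambda>n j. - V' n j) (\<lambda>n j. - U' n j) (- (S + 1 / 2))"
      using bal column_pairs_uminus[OF cp(2)]
      unfolding balanced_pairs_def balanced_pairs_axioms_def by fastforce
    note * = odd_sums_sorted[OF column_pairs_uminus[OF cp(1)] bal'[unfolded S] Ints_of_int _ _ D_def]
    have 1: "of_int v \<le> - V D j \<and> - V D j \<le> of_int v + 1 \<and> - U D j = of_int v + 1" if "1 \<le> j" "j \<le> m" for j
      using that ints e by (intro *(1)) (auto simp: U_def V_def U'_def V'_def abs_minus_commute)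
    have 2: "- V D j \<le> - V D (Suc j)" if "1 \<le> j" "j < m" for j
      using that ints e by (intro *(2)) (auto simp: U_def V_def U'_def V'_def abs_minus_commute)
    show ?thesis unfolding D_def[symmetric]
    proof (rule flat_of_halves[OF m1])
      fix j assume j: "1 \<le> j" "j < m"
      show "orbit p k c D (Suc (2 * m - Suc j)) \<le> orbit p k c D (Suc (2 * m - j))"
        using 2[OF j] unfolding V_def by simp
      show "orbit p k c D j \<le> orbit p k c D (Suc j)"
        using 1[of j] 1[of "Suc j"] j unfolding U_def by auto
    next
      show "orbit p k c D m \<le> orbit p k c D (Suc m)" "orbit p k c D (2 * m) \<le> orbit p k c D 1 + 1"
        using 1[of 1] 1[of m] m1 unfolding V_def U_def by auto
    qed
  qed
qed

theorem theorem3p43: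
  fixes p k b D :: nat and c :: "nat \<Rightarrow> real" and f :: "nat \<Rightarrow> (nat \<Rightarrow> real) \<Rightarrow> nat \<Rightarrow> real"
  assumes "4 \<le> p" and "p \<le> k"
    and "b = 2 * nat \<lceil>(real k - 2) / (real p - 2)\<rceil>"
    and "D = p * (b - 1)"
    and "two_flat b c"
    and "\<And>i. i \<in> {1..b} \<Longrightarrow> c i \<in> \<int> \<and> 0 \<le> c i \<and> c i \<le> 2 ^ (k - 1) - 1"
    and "\<And>i. i \<in> {1..D} \<Longrightarrow> f i = Qmap p k ((i - 1) mod p + 1)"
  shows "flat b (fold f [1..<D + 1] c)"
proof -
  define m where "m = nat \<lceil>(real k - 2) / (real p - 2)\<rceil>"
  have b: "b = 2 * m" and m: "blk p k = 2 * m" using assms(3) unfolding m_def blk_def by auto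
  \<comment> \<open>\<open>f (n + 1)\<close> has index \<open>n mod p + 1\<close>, the one
    \<open>orbit\<close> uses to pass from \<open>n\<close> to \<open>n + 1\<close>.\<close>
  have "fold f [1..<n + 1] c = orbit p k c n" if "n \<le> D" for n
    using that by (induction n) (auto simp: assms(7))
  from this[of D] have "fold f [1..<D + 1] c = orbit p k c (p * (2 * m - 1))"
    unfolding assms(4) b by (simp only: order.refl)
  then show ?thesis
    unfolding b using orbit_flat[OF assms(1,2) m] assms(5,6) unfolding b by simp
qed

end
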